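(* For any rational number $t > 1/2$, every minimally $t$-tough graph contains a hole or an induced $k$-sun for some integer $k \ge 3$.
   Context: All graphs are finite, simple and undirected. $\omega(H)$ denotes the number of connected components of a graph $H$. For a real number $t$, a graph $G$ is $t$-tough if $|S| \ge t\cdot\omega(G-S)$ for every $S \subseteq V(G)$ with $\omega(G-S) > 1$. The toughness $\tau(G)$ is the largest $t$ for which $G$ is $t$-tough, where $\tau(K_n)=\infty$ for all $n\ge 1$. A graph $G$ is minimally $t$-tough if $\tau(G)=t$ and $\tau(G-e)<t$ for every $e\in E(G)$. A hole in a graph is an induced cycle of length at least $4$. For an integer $k\ge 3$, the $k$-sun is the graph whose vertex set is partitioned into $A=\{a_1,\ldots,a_k\}$ and $B=\{b_1,\ldots,b_k\}$ such that $A$ is a clique, $B$ is an independent set, and for all $i,j\in\{1,\ldots,k\}$ the vertices $a_i$ and $b_j$ are adjacent if and only if $i=j$ or $i\equiv j+1 \pmod{k}$. Containing an induced $k$-sun means having an induced subgraph isomorphic to the $k$-sun. *)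

theory Defs
  imports
    "Graph_Theory.Graph_Theory"
    "HOL-Library.Extended_Real"
    "HOL-Number_Theory.Cong"
begin

text \<open>
  A finite simple undirected graph is a \<open>pair_graph\<close>: a finite, loop-free, symmetric digraph
  without parallel arcs, an undirected edge \<open>uv\<close> being the pair of arcs \<open>(u,v)\<close>, \<open>(v,u)\<close>.
  Since arcs come in both directions, the strongly connected components \<open>sccs\<close> of such a
  digraph are the connected components of the undirected graph.
\<close>

definition num_components :: "('a,'b) pre_digraph \<Rightarrow> nat" (\<open>\<omega>\<close>) where
  "\<omega> H = card (pre_digraph.sccs H)"

definition del_verts :: "('a,'b) pre_digraph \<Rightarrow> 'a set \<Rightarrow> ('a,'b) pre_digraph" where
  "del_verts G S = G \<restriction> (verts G - S)"

definition del_edge :: "'a pair_pre_digraph \<Rightarrow> 'a \<Rightarrow> 'a \<Rightarrow> 'a pair_pre_digraph" where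
  "del_edge G u v = G\<lparr>parcs := parcs G - {(u,v), (v,u)}\<rparr>"

definition tough :: "real \<Rightarrow> ('a,'b) pre_digraph \<Rightarrow> bool" where
  "tough t G \<longleftrightarrow>
     (\<forall>S \<subseteq> verts G. \<omega> (del_verts G S) > 1 \<longrightarrow> real (card S) \<ge> t * real (\<omega> (del_verts G S)))"

text \<open>
  The maximum exists for every finite simple graph that is not complete;
  see \<open>tough_Greatest\<close> below.
\<close>

definition toughness :: "('a,'b) pre_digraph \<Rightarrow> ereal" (\<open>\<tau>\<close>) where
  "\<tau> G = (if complete_digraph (card (verts G)) G then \<infinity> else ereal (GREATEST t. tough t G))"

definition minimally_tough :: "real \<Rightarrow> 'a pair_pre_digraph \<Rightarrow> bool" where
  "minimally_tough t G \<longleftrightarrow>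
     \<tau> (with_proj G) = ereal t \<and>
     (\<forall>(u,v) \<in> parcs G. \<tau> (with_proj (del_edge G u v)) < ereal t)"

definition contains_induced :: "'a pair_pre_digraph \<Rightarrow> 'b pair_pre_digraph \<Rightarrow> bool" where
  "contains_induced G F \<longleftrightarrow>
     (\<exists>H. induced_subgraph H (with_proj G) \<and> digraph_iso H (with_proj F))"

definition cycle_graph :: "nat \<Rightarrow> nat pair_pre_digraph" where
  "cycle_graph k = \<lparr> pverts = {0..<k},
     parcs = {(i, j). i < k \<and> j < k \<and> (j = (i + 1) mod k \<or> i = (j + 1) mod k)} \<rparr>"

definition has_hole :: "'a pair_pre_digraph \<Rightarrow> bool" where
  "has_hole G \<longleftrightarrow> (\<exists>k\<ge>4. contains_induced G (cycle_graph k))"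

text \<open>The vertices \<open>a\<^sub>i\<close> and \<open>b\<^sub>j\<close> of the \<open>k\<close>-sun are \<open>Inl i\<close> and \<open>Inr j\<close>.\<close>

definition sun_adj :: "nat \<Rightarrow> nat \<Rightarrow> nat \<Rightarrow> bool" where
  "sun_adj k i j \<longleftrightarrow> i = j \<or> [i = j + 1] (mod k)"

definition sun_graph :: "nat \<Rightarrow> (nat + nat) pair_pre_digraph" where
  "sun_graph k = \<lparr> pverts = Inl ` {1..k} \<union> Inr ` {1..k},
     parcs = {(Inl i, Inl j) | i j. i \<in> {1..k} \<and> j \<in> {1..k} \<and> i \<noteq> j}
       \<union> {(Inl i, Inr j) | i j. i \<in> {1..k} \<and> j \<in> {1..k} \<and> sun_adj k i j}
       \<union> {(Inr j, Inl i) | i j. i \<in> {1..k} \<and> j \<in> {1..k} \<and> sun_adj k i j} \<rparr>"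

lemma pair_graph_cycle_graph:
  assumes "k \<ge> 3"
  shows "pair_graph (cycle_graph k)"
proof -
  have fin: "finite (parcs (cycle_graph k))"
    by (rule finite_subset[of _ "{0..<k} \<times> {0..<k}"]) (auto simp: cycle_graph_def)
  have no_fix: "Suc i mod k \<noteq> i" if "i < k" for i
    using that assms by (cases "Suc i = k") auto
  show ?thesis
    using fin
    by unfold_locales
      (auto simp: cycle_graph_def symmetric_def sym_def arcs_ends_def arc_to_ends_def no_fix no_fix[symmetric])
qed

lemma pair_graph_sun_graph: "pair_graph (sun_graph k)"
proof -
  let ?V = "Inl ` {1..k} \<union> Inr ` {1..k} :: (nat + nat) set"
  have fin: "finite (parcs (sun_graph k))"
    by (rule finite_subset[of _ "?V \<times> ?V"]) (auto simp: sun_graph_def)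
  show ?thesis
    using fin
    by unfold_locales
      (auto simp: sun_graph_def symmetric_def sym_def arcs_ends_def arc_to_ends_def)
qed

lemma pair_graph_del_edge:
  assumes "pair_graph G"
  shows "pair_graph (del_edge G u v)"
proof -
  interpret pair_graph G by fact
  show ?thesis
    using pair_sym_arcs
    by unfold_locales
      (auto simp: del_edge_def symmetric_def sym_def arcs_ends_def arc_to_ends_def
        dest: arc_fst_in_verts arc_snd_in_verts pair_no_loops)
qed

lemma non_complete_separator:
  assumes G: "pair_graph G" and nc: "\<not> complete_digraph (card (pverts G)) (with_proj G)"
  shows "\<exists>S \<subseteq> pverts G. \<omega> (del_verts (with_proj G) S) > 1"
proof -
  interpret pair_graph G by fact
  obtain u v where uv: "u \<in> pverts G" "v \<in> pverts G" "u \<noteq> v" "(u,v) \<notin> parcs G"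
  proof -
    have "parcs G \<subseteq> {(u,v). (u,v) \<in> pverts G \<times> pverts G \<and> u \<noteq> v}"
      using pair_no_loops arc_fst_in_verts arc_snd_in_verts by fastforce
    moreover have "parcs G \<noteq> {(u,v). (u,v) \<in> pverts G \<times> pverts G \<and> u \<noteq> v}"
      using nc pair_finite_verts by (simp add: complete_digraph_pair_def)
    ultimately show ?thesis using that by blast
  qed
  have vu: "(v,u) \<notin> parcs G"
    using uv(4) pair_sym_arcs by (auto simp: symmetric_def sym_def)
  let ?S = "pverts G - {u,v}"
  let ?H = "del_verts (with_proj G) ?S"
  have vH: "verts ?H = {u,v}"
    using uv by (auto simp: del_verts_def)
  have aH: "arcs ?H = {}"
    using uv vu no_loops' by (auto simp: del_verts_def induce_subgraph_def)
  have eH: "arcs_ends ?H = {}"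
    using aH by (simp add: arcs_ends_def)
  interpret H: wf_digraph ?H
    by unfold_locales (simp_all add: aH)
  have reach: "x \<rightarrow>\<^sup>*\<^bsub>?H\<^esub> y \<longleftrightarrow> x = y \<and> x \<in> {u,v}" for x y
    unfolding reachable_def eH vH
    by (auto elim: rtrancl_on.cases intro: rtrancl_on.intros)
  have "{u} \<in> H.sccs_verts" "{v} \<in> H.sccs_verts"
    by (auto simp: H.in_sccs_verts_conv_reachable reach)
  moreover have "H.sccs_verts \<subseteq> Pow {u,v}"
    unfolding H.sccs_verts_def reach by blast
  ultimately have "card {{u},{v}} \<le> card H.sccs_verts"
    by (intro card_mono) (auto intro: finite_subset)
  then have "\<omega> ?H > 1"
    using uv(3) by (simp add: num_components_def H.card_sccs_verts)
  then show ?thesis by blast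
qed

lemma tough_Greatest:
  assumes G: "pair_graph G" and nc: "\<not> complete_digraph (card (pverts G)) (with_proj G)"
  shows "tough t (with_proj G) \<longleftrightarrow> t \<le> (GREATEST t. tough t (with_proj G))"
proof -
  interpret pair_graph G by fact
  let ?w = "\<lambda>S. real (\<omega> (del_verts (with_proj G) S))"
  let ?Q = "(\<lambda>S. real (card S) / ?w S) ` {S. S \<subseteq> pverts G \<and> \<omega> (del_verts (with_proj G) S) > 1}"
  have fin: "finite ?Q"
    using pair_finite_verts by auto
  have ne: "?Q \<noteq> {}"
    using non_complete_separator[OF G nc] by auto
  have t: "tough t (with_proj G) \<longleftrightarrow> t \<le> Min ?Q" for t
    unfolding Min_ge_iff[OF fin ne] tough_def by (auto simp: le_divide_eq)
  have "(GREATEST t. tough t (with_proj G)) = Min ?Q"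
    by (rule Greatest_equality) (auto simp: t)
  then show ?thesis by (simp add: t)
qed

end

theory Submission
  imports Defs
begin

text \<open>
  Order the rows (maximal cliques) and columns (vertices) of the clique matrix doubly lexically.
  In a graph without holes and suns the first row is then a clique \<open>K\<close> in which neighbourhoods
  are nested, for otherwise two rows and columns violating this grow to a special cycle, a shortest
  one of which is a hole or the central clique of a sun. So \<open>K\<close> is the closed neighbourhood of a
  simplicial vertex and contains \<open>u\<close> with \<open>N[x] \<subseteq> N[u]\<close> for all \<open>x \<in> K\<close>.

  Toughness gives \<open>|K| - 1 \<ge> 2t\<close>. For \<open>x \<in> K - {u}\<close> let \<open>S\<close> witness that \<open>G - xu\<close> is not
  \<open>t\<close>-tough. Then \<open>N(x) - {u} \<subseteq> S\<close>, and \<open>S - (K - {x, u})\<close> leaves at most one component less in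
  \<open>G\<close> than \<open>S\<close> does in \<open>G - xu\<close>. As \<open>|K| - 2 \<ge> t\<close>, this is only possible if the former
  graph is connected and \<open>|S| < 2t\<close>, whence \<open>N[x] = K\<close>. So \<open>u\<close> is a cut vertex and \<open>t \<le> 1/2\<close>.
\<close>

section \<open>Doubly lexical orderings\<close>

lemma sum_pow2_inj_less:
  fixes s :: "'b \<Rightarrow> nat"
  assumes "finite Y" "inj_on s Y" "\<And>y. y \<in> Y \<Longrightarrow> s y < n"
  shows "(\<Sum>y\<in>Y. (2::nat) ^ s y) < 2 ^ n"
proof -
  have "(\<Sum>y\<in>Y. (2::nat) ^ s y) = (\<Sum>i\<in>s ` Y. 2 ^ i)"
    using assms(2) by (simp add: sum.reindex)
  also have "\<dots> \<le> (\<Sum>i<n. 2 ^ i)"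
    using assms(3) by (intro sum_mono2) auto
  also have "\<dots> < 2 ^ n"
    by (induction n) auto
  finally show ?thesis .
qed

text \<open>Binary numbers are compared at the highest digit in which they differ. If that digit
  belonged to \<open>X\<close>, it alone would outweigh all of \<open>Y - X\<close>; so it belongs
  to \<open>Y\<close>, and being highest it lies above \<open>r\<close>.\<close>

lemma binary_le_last_difference:
  fixes s :: "'b \<Rightarrow> nat"
  assumes fin: "finite X" "finite Y" and inj: "inj_on s (X \<union> Y)"
    and le: "(\<Sum>x\<in>X. (2::nat) ^ s x) \<le> (\<Sum>x\<in>Y. 2 ^ s x)"
    and r: "r \<in> X" "r \<notin> Y"
  obtains r' where "r' \<in> Y" "r' \<notin> X" "s r < s r'" "\<And>x. s r' < s x \<Longrightarrow> x \<in> X \<longleftrightarrow> x \<in> Y"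
proof -
  define D where "D = (X - Y) \<union> (Y - X)"
  have D: "finite D" "r \<in> D" using fin r by (auto simp: D_def)
  then have "Max (s ` D) \<in> s ` D" by (intro Max_in) auto
  then obtain r' where r': "r' \<in> D" "s r' = Max (s ` D)" by (metis imageE)
  have max: "s x \<le> s r'" if "x \<in> D" for x
    using that D by (simp add: r'(2))
  have split: "(\<Sum>x\<in>A. (2::nat) ^ s x) = (\<Sum>x\<in>A \<inter> B. 2 ^ s x) + (\<Sum>x\<in>A - B. 2 ^ s x)"
    if "finite A" for A B :: "'b set"
    using that by (rule sum.Int_Diff)
  have "r' \<in> Y \<and> r' \<notin> X"
  proof (rule ccontr)
    assume "\<not> ?thesis"
    then have rX: "r' \<in> X - Y" using r'(1) by (auto simp: D_def)
    have "(\<Sum>x\<in>Y - X. (2::nat) ^ s x) < 2 ^ s r'"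
    proof (rule sum_pow2_inj_less)
      show "inj_on s (Y - X)" using inj by (rule inj_on_subset) auto
      show "s y < s r'" if "y \<in> Y - X" for y
      proof -
        have "s y \<noteq> s r'" using that rX inj by (auto dest: inj_onD)
        then show ?thesis using max[of y] that by (simp add: D_def)
      qed
    qed (use fin in simp)
    also have "\<dots> \<le> (\<Sum>x\<in>X - Y. (2::nat) ^ s x)"
      using rX fin by (intro member_le_sum) auto
    finally show False
      using le split[OF fin(1), of Y] split[OF fin(2), of X] unfolding Int_commute[of Y X] by linarith
  qed
  moreover have "s r < s r'"
  proof -
    have "s r \<noteq> s r'" using r calculation inj by (auto dest: inj_onD)
    then show ?thesis using max[OF D(2)] by simp
  qed
  moreover have "x \<in> X \<longleftrightarrow> x \<in> Y" if "s r' < s x" for x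
    using max[of x] that by (auto simp: D_def)
  ultimately show ?thesis using that by blast
qed

text \<open>Exchanging two values of \<open>p\<close> that are in the wrong order would increase the sum.\<close>

lemma maximal_weight_sum_mono:
  fixes p w :: "'c \<Rightarrow> nat"
  assumes fin: "finite C" and inj: "inj_on p C" and p: "p ` C \<subseteq> A"
    and max: "\<And>q. inj_on q C \<Longrightarrow> q ` C \<subseteq> A \<Longrightarrow> (\<Sum>c\<in>C. w c * 2 ^ q c) \<le> (\<Sum>c\<in>C. w c * 2 ^ p c)"
    and c: "c \<in> C" "c' \<in> C" "p c < p c'"
  shows "w c \<le> w c'"
proof (rule ccontr)
  assume "\<not> w c \<le> w c'"
  then obtain d where d: "w c = w c' + d" "d > 0"
    by (metis not_le_imp_less less_imp_add_positive)
  define q where "q = p(c := p c', c' := p c)"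
  have ne: "c \<noteq> c'" using c by auto
  have "(\<Sum>x\<in>C. w x * 2 ^ q x) \<le> (\<Sum>x\<in>C. w x * 2 ^ p x)"
  proof (rule max)
    show "inj_on q C"
      using inj c ne by (auto simp: q_def inj_on_def)
    show "q ` C \<subseteq> A" using p c by (auto simp: q_def)
  qed
  moreover have "(\<Sum>x\<in>C. w x * 2 ^ f x) =
      w c * 2 ^ f c + (w c' * 2 ^ f c' + (\<Sum>x\<in>C - {c} - {c'}. w x * 2 ^ f x))" for f :: "'c \<Rightarrow> nat"
    using fin c ne by (subst sum.remove[of C c], simp, simp, subst sum.remove[of _ c'], auto)
  moreover have "(\<Sum>x\<in>C - {c} - {c'}. w x * 2 ^ q x) = (\<Sum>x\<in>C - {c} - {c'}. w x * 2 ^ p x)"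
    by (rule sum.cong) (auto simp: q_def)
  ultimately have "w c * 2 ^ p c' + w c' * 2 ^ p c \<le> w c * 2 ^ p c + w c' * 2 ^ p c'"
    using ne by (simp add: q_def)
  then have "d * 2 ^ p c' \<le> d * 2 ^ p c"
    by (simp add: d algebra_simps)
  then show False using d c(3) by simp
qed

text \<open>One half of a doubly lexical ordering: columns, read from the last row downwards,
  increase lexicographically along \<open>p\<close>, with \<open>r'\<close> the last row in which
  two of them differ. Positions are functions, so the other half is the same condition for the
  transposed relation with \<open>s\<close> and \<open>p\<close> exchanged.\<close>

definition doubly_lexical :: "('b \<Rightarrow> 'c \<Rightarrow> bool) \<Rightarrow> 'c set \<Rightarrow> ('b \<Rightarrow> nat) \<Rightarrow> ('c \<Rightarrow> nat) \<Rightarrow> bool" where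
  "doubly_lexical M C s p \<longleftrightarrow>
     (\<forall>r c c'. c \<in> C \<and> c' \<in> C \<and> p c < p c' \<and> M r c \<and> \<not> M r c' \<longrightarrow>
       (\<exists>r'. s r < s r' \<and> \<not> M r' c \<and> M r' c' \<and> (\<forall>x. s r' < s x \<longrightarrow> (M x c \<longleftrightarrow> M x c'))))"

text \<open>For fixed \<open>s\<close> each column is a binary number. Maximality sorts these
  numbers along \<open>p\<close>, and the highest digit in which two of them differ is the required
  row.\<close>

lemma doubly_lexical_of_max:
  assumes fin: "finite R" "finite C" and M: "\<And>r c. M r c \<Longrightarrow> r \<in> R \<and> c \<in> C"
    and s: "inj_on s R" and p: "inj_on p C" "p ` C \<subseteq> A"
    and max: "\<And>q. inj_on q C \<Longrightarrow> q ` C \<subseteq> A \<Longrightarrow>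
        (\<Sum>c\<in>C. \<Sum>r | M r c. (2::nat) ^ s r * 2 ^ q c) \<le> (\<Sum>c\<in>C. \<Sum>r | M r c. 2 ^ s r * 2 ^ p c)"
  shows "doubly_lexical M C s p"
  unfolding doubly_lexical_def
proof (intro allI impI; elim conjE)
  fix r c c' assume c: "c \<in> C" "c' \<in> C" "p c < p c'" and r: "M r c" "\<not> M r c'"
  have sub: "{r. M r c} \<subseteq> R" for c using M by auto
  have "(\<Sum>r | M r c. (2::nat) ^ s r) \<le> (\<Sum>r | M r c'. 2 ^ s r)"
    using maximal_weight_sum_mono[where w = "\<lambda>c. \<Sum>r | M r c. 2 ^ s r", OF fin(2) p _ c] max
    by (simp add: sum_distrib_right)
  then obtain r' where "r' \<in> {r. M r c'}" "r' \<notin> {r. M r c}" "s r < s r'"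
      "\<And>x. s r' < s x \<Longrightarrow> x \<in> {r. M r c} \<longleftrightarrow> x \<in> {r. M r c'}"
  proof (rule binary_le_last_difference[rotated 3])
    show "finite {r. M r c}" "finite {r. M r c'}"
      using sub fin(1) by (auto intro: finite_subset)
    show "inj_on s ({r. M r c} \<union> {r. M r c'})"
      using s sub by (meson Un_least inj_on_subset)
  qed (use r in auto)
  then show "\<exists>r'. s r < s r' \<and> \<not> M r' c \<and> M r' c' \<and> (\<forall>x. s r' < s x \<longrightarrow> (M x c \<longleftrightarrow> M x c'))"
    by blast
qed

text \<open>The sum of \<open>2 ^ s r * 2 ^ p c\<close> over all incidences treats rows and columns
  alike. A pair maximizing it is optimal in each argument separately, which gives both halves of the
  ordering.\<close>

lemma ex_doubly_lexical:
  assumes fin: "finite R" "finite C" and M: "\<And>r c. M r c \<Longrightarrow> r \<in> R \<and> c \<in> C"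
  obtains s :: "'b \<Rightarrow> nat" and p :: "'c \<Rightarrow> nat"
  where "inj_on s R" "inj_on p C" "s ` R \<subseteq> {..<card R}"
    "doubly_lexical M C s p" "doubly_lexical (\<lambda>c r. M r c) R p s"
proof -
  define P where "P = (\<lambda>(s::'b \<Rightarrow> nat, p::'c \<Rightarrow> nat). inj_on s R \<and> s ` R \<subseteq> {..<card R} \<and>
    inj_on p C \<and> p ` C \<subseteq> {..<card C})"
  define \<Phi> where "\<Phi> = (\<lambda>(s::'b \<Rightarrow> nat, p::'c \<Rightarrow> nat). \<Sum>c\<in>C. \<Sum>r | M r c. (2::nat) ^ s r * 2 ^ p c)"
  have alt: "\<Phi> (s, p) = (\<Sum>r\<in>R. \<Sum>c | M r c. 2 ^ p c * 2 ^ s r)" for s p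
  proof -
    have "{r. M r c} = {r \<in> R. M r c}" "{c. M r c} = {c \<in> C. M r c}" for r c
      using M by blast+
    then have "\<Phi> (s, p) = (\<Sum>c\<in>C. \<Sum>r\<in>R. if M r c then 2 ^ s r * 2 ^ p c else 0)"
      by (simp add: \<Phi>_def sum.inter_filter[OF fin(1)])
    also have "\<dots> = (\<Sum>r\<in>R. \<Sum>c\<in>C. if M r c then 2 ^ s r * 2 ^ p c else 0)"
      by (rule sum.swap)
    also have "\<dots> = (\<Sum>r\<in>R. \<Sum>c | M r c. 2 ^ p c * 2 ^ s r)"
      using \<open>\<And>r. {c. M r c} = {c \<in> C. M r c}\<close>
      by (simp add: sum.inter_filter[OF fin(2)] mult.commute cong: if_cong)
    finally show ?thesis .
  qed
  obtain s0 where "bij_betw s0 R {..<card R}"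
    using finite_same_card_bij[OF fin(1), of "{..<card R}"] by auto
  moreover obtain p0 where "bij_betw p0 C {..<card C}"
    using finite_same_card_bij[OF fin(2), of "{..<card C}"] by auto
  ultimately have P0: "P (s0, p0)" by (auto simp: P_def bij_betw_def)
  \<comment> \<open>A crude bound, which makes a maximum of \<open>\<Phi>\<close> exist.\<close>
  have "\<forall>y. P y \<longrightarrow> \<Phi> y < Suc (\<Sum>c\<in>C. \<Sum>r\<in>R. 2 ^ card R * 2 ^ card C)"
  proof (intro allI impI le_imp_less_Suc)
    fix y assume "P y"
    moreover obtain s p where y: "y = (s, p)" by force
    ultimately have lt: "s r < card R" "p c < card C" if "r \<in> R" "c \<in> C" for r c
      using that by (auto simp: P_def)
    have "(\<Sum>r | M r c. (2::nat) ^ s r * 2 ^ p c) \<le> (\<Sum>r\<in>R. 2 ^ card R * 2 ^ card C)" if "c \<in> C" for c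
    proof -
      have "(\<Sum>r | M r c. (2::nat) ^ s r * 2 ^ p c) \<le> (\<Sum>r\<in>R. 2 ^ s r * 2 ^ p c)"
        using M by (intro sum_mono2[OF fin(1)]) auto
      also have "\<dots> \<le> (\<Sum>r\<in>R. 2 ^ card R * 2 ^ card C)"
        using lt that by (intro sum_mono mult_mono power_increasing) (auto intro: less_imp_le)
      finally show ?thesis .
    qed
    then show "\<Phi> y \<le> (\<Sum>c\<in>C. \<Sum>r\<in>R. 2 ^ card R * 2 ^ card C)"
      unfolding \<Phi>_def y prod.case by (intro sum_mono)
  qed
  from ex_has_greatest_nat[OF P0 this]
  obtain x where x: "P x" "\<And>y. P y \<Longrightarrow> \<Phi> y \<le> \<Phi> x" by blast
  obtain s p where sp: "x = (s, p)" by force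
  have inj: "inj_on s R" "inj_on p C" "s ` R \<subseteq> {..<card R}" "p ` C \<subseteq> {..<card C}"
    using x(1) by (auto simp: P_def sp)
  have "doubly_lexical M C s p"
  proof (rule doubly_lexical_of_max[OF fin _ inj(1,2,4)])
    fix q :: "'c \<Rightarrow> nat" assume "inj_on q C" "q ` C \<subseteq> {..<card C}"
    then have "\<Phi> (s, q) \<le> \<Phi> (s, p)" using x inj by (auto simp: P_def sp)
    then show "(\<Sum>c\<in>C. \<Sum>r | M r c. (2::nat) ^ s r * 2 ^ q c) \<le> (\<Sum>c\<in>C. \<Sum>r | M r c. 2 ^ s r * 2 ^ p c)"
      by (simp add: \<Phi>_def)
  qed (use M in auto)
  moreover have "doubly_lexical (\<lambda>c r. M r c) R p s"
  proof (rule doubly_lexical_of_max[OF fin(2,1) _ inj(2,1,3)])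
    fix q :: "'b \<Rightarrow> nat" assume "inj_on q R" "q ` R \<subseteq> {..<card R}"
    then have "\<Phi> (q, p) \<le> \<Phi> (s, p)" using x inj by (auto simp: P_def sp)
    then show "(\<Sum>c\<in>R. \<Sum>r | M c r. (2::nat) ^ p r * 2 ^ q c) \<le> (\<Sum>c\<in>R. \<Sum>r | M c r. 2 ^ p r * 2 ^ s c)"
      by (simp add: alt)
  qed (use M in auto)
  ultimately show ?thesis by (rule that[OF inj(1-3)])
qed

section \<open>Special cycles in incidence relations\<close>

text \<open>A submatrix that is the incidence matrix of a cycle; matrices without one are called
  totally balanced. For \<open>k \<ge> 3\<close> the pattern itself forces the rows to be distinct,
  and likewise the columns.\<close>

definition special_cycle :: "('b \<Rightarrow> 'c \<Rightarrow> bool) \<Rightarrow> nat \<Rightarrow> (nat \<Rightarrow> 'b) \<Rightarrow> (nat \<Rightarrow> 'c) \<Rightarrow> bool" where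
  "special_cycle M k r c \<longleftrightarrow> k \<ge> 3 \<and>
     (\<forall>i<k. \<forall>j<k. M (r i) (c j) \<longleftrightarrow> j = i \<or> j = Suc i mod k)"

text \<open>The path \<open>c 0, r 0, c 1, r 1, \<dots>, c L, r L\<close> is extended at both ends, by the last row
  distinguishing its first and last column and by the last column distinguishing its first and
  last row; the extended path is traversed backwards.\<close>

lemma special_cycle_of_induced_path:
  assumes "\<And>x y. M x y \<Longrightarrow> s x < m \<and> x \<in> R \<and> y \<in> C"
    and "doubly_lexical M C s p" "doubly_lexical (\<lambda>c r. M r c) R p s"
    and "L \<ge> 1" "L = 1 \<Longrightarrow> \<not> M (r L) (c 0)"
    and "\<And>i j. i \<le> L \<Longrightarrow> j \<le> L \<Longrightarrow> i \<noteq> L \<or> j \<noteq> 0 \<Longrightarrow> M (r i) (c j) \<longleftrightarrow> j = i \<or> j = Suc i"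
    and "s (r 0) < s (r L)" "p (c L) < p (c 0)"
    and "\<And>y i. p (c 0) < p y \<Longrightarrow> i < L \<Longrightarrow> M (r i) y \<longleftrightarrow> M (r 0) y"
    and "\<And>x j. s (r L) < s x \<Longrightarrow> 1 \<le> j \<Longrightarrow> j \<le> L \<Longrightarrow> M x (c j) \<longleftrightarrow> M x (c L)"
  shows "\<exists>k r c. special_cycle M k r c"
  using assms(4-)
\<comment> \<open>Each extension ends in a later row, and \<open>m\<close> bounds the positions of
  rows, so the growth stops.\<close>
proof (induction "m - s (r L)" arbitrary: L r c rule: less_induct)
  case less
  note M = less.prems(3)
  show ?case
  proof (cases "M (r L) (c 0)")
    \<comment> \<open>The corner entry, on which the path assumptions are silent for larger
      \<open>L\<close>, closes the path; the assumption for \<open>L = 1\<close> rules out a cycle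
      of length 2.\<close>
    case True
    then have "L \<ge> 2" using less.prems(1,2) by (cases "L = 1") auto
    moreover have "M (r i) (c j) \<longleftrightarrow> j = i \<or> j = Suc i mod Suc L" if "i < Suc L" "j < Suc L" for i j
      using M[of i j] True that by (cases "i = L \<and> j = 0") (auto simp: mod_Suc)
    ultimately have "special_cycle M (Suc L) r c"
      by (simp add: special_cycle_def)
    then show ?thesis by blast
  next
    case False
    have e: "M (r 0) (c 0)" "M (r L) (c L)" "r 0 \<in> R" "r L \<in> R" "c 0 \<in> C" "c L \<in> C"
      using M[of 0 0] M[of L L] less.prems(1) assms(1) by auto
    have lr: "p (c L) < p (c 0)" "s (r 0) < s (r L)" using less.prems(4,5) by auto
    \<comment> \<open>Row \<open>r L\<close> contains \<open>c L\<close> but not the later column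
      \<open>c 0\<close>, so the column order yields \<open>x\<close>. Column \<open>c 0\<close>
      lies in \<open>r 0\<close> but not in the later row \<open>r L\<close>, so the row order
      yields \<open>y\<close>.\<close>
    obtain x where x: "s (r L) < s x" "\<not> M x (c L)" "M x (c 0)"
        "\<And>z. s x < s z \<Longrightarrow> M z (c L) \<longleftrightarrow> M z (c 0)"
      using assms(2)[unfolded doubly_lexical_def, rule_format, of "c L" "c 0" "r L"]
        e False lr by blast
    obtain y where y: "p (c 0) < p y" "\<not> M (r 0) y" "M (r L) y"
        "\<And>z. p y < p z \<Longrightarrow> M (r 0) z \<longleftrightarrow> M (r L) z"
      using assms(3)[unfolded doubly_lexical_def, rule_format, of "r 0" "r L" "c 0"]
        e False lr by blast
    define c' where "c' = (\<lambda>j. if j = 0 then y else c (Suc L - j))"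
    define r' where "r' = (\<lambda>i. if i = Suc L then x else r (L - i))"
    \<comment> \<open>\<open>y\<close> lies beyond \<open>c 0\<close>, where all rows before
      \<open>r L\<close> agree; as \<open>r 0\<close> misses \<open>y\<close>, so do they. The
      argument for \<open>x\<close> is dual.\<close>
    have rx: "M (r j) y \<longleftrightarrow> j = L" if "j \<le> L" for j
      using less.prems(6)[OF y(1), of j] y(2,3) that by (cases "j = L") auto
    have cx: "M x (c j) \<longleftrightarrow> j = 0" if "j \<le> L" for j
      using less.prems(7)[OF x(1), of j] x(2,3) that by (cases "j = 0") auto
    show ?thesis
    proof (rule less.hyps[of r' "Suc L" c'])
      show "m - s (r' (Suc L)) < m - s (r L)"
        using x(1) assms(1)[OF x(3)] by (auto simp: r'_def intro!: diff_less_mono2)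
      show "M (r' i) (c' j) \<longleftrightarrow> j = i \<or> j = Suc i"
        if "i \<le> Suc L" "j \<le> Suc L" "i \<noteq> Suc L \<or> j \<noteq> 0" for i j
      proof (cases "i = Suc L \<or> j = 0")
        case True
        then show ?thesis
          using that less.prems(1) by (auto simp: r'_def c'_def rx cx)
      next
        case F: False
        then have "i \<le> L" "Suc L - j \<le> L" "j \<ge> 1" using that by auto
        show ?thesis
        \<comment> \<open>This pair is the corner entry of the old path, which is false in the
          present case.\<close>
        proof (cases "i = 0 \<and> j = Suc L")
          case True
          then show ?thesis using False less.prems(1) by (simp add: r'_def c'_def)
        next
          case False
          have "M (r (L - i)) (c (Suc L - j)) \<longleftrightarrow> Suc L - j = L - i \<or> Suc L - j = Suc (L - i)"
            by (rule M) (use F False that in arith)+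
          moreover have "\<dots> \<longleftrightarrow> j = i \<or> j = Suc i" using F that by arith
          ultimately show ?thesis using F by (simp add: r'_def c'_def)
        qed
      qed
      \<comment> \<open>Beyond \<open>y\<close> the rows \<open>r 0\<close> and \<open>r L\<close>
        no longer differ, so the agreement of the earlier rows extends to
        \<open>r L\<close>.\<close>
      show "M (r' i) z \<longleftrightarrow> M (r' 0) z" if "p (c' 0) < p z" "i < Suc L" for z i
      proof -
        have pz: "p y < p z" using that by (simp add: c'_def)
        have "M (r (L - i)) z \<longleftrightarrow> M (r L) z"
        proof (cases "L - i = L")
          case False
          then have "M (r (L - i)) z \<longleftrightarrow> M (r 0) z"
            using less.prems(6)[of z "L - i"] y(1) pz by linarith
          then show ?thesis using y(4)[OF pz] by blast
        qed simp
        then show ?thesis using that by (simp add: r'_def)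
      qed
      show "M z (c' j) \<longleftrightarrow> M z (c' (Suc L))" if "s (r' (Suc L)) < s z" "1 \<le> j" "j \<le> Suc L" for z j
      proof -
        have sz: "s x < s z" using that by (simp add: r'_def)
        have "M z (c (Suc L - j)) \<longleftrightarrow> M z (c 0)"
        proof (cases "Suc L - j = 0")
          case False
          then have "M z (c (Suc L - j)) \<longleftrightarrow> M z (c L)"
            using less.prems(7)[of z "Suc L - j"] x(1) sz that by linarith
          then show ?thesis using x(4)[OF sz] by blast
        qed simp
        then show ?thesis using that by (simp add: c'_def)
      qed
    qed (use x(1) y(1) less.prems(1) in \<open>simp_all add: r'_def c'_def\<close>)
  qed
qed

text \<open>Let \<open>r\<close> be the first row and \<open>c\<close> before \<open>c'\<close> two
  of its columns. A row \<open>x\<close> containing \<open>c\<close> but not \<open>c'\<close> would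
  give the path \<open>c', r, c, x\<close>; its agreement conditions are trivial for
  \<open>L = 1\<close>, so it would grow to a special cycle.\<close>

lemma ex_nested_row:
  assumes fin: "finite R" "finite C" and M: "\<And>r c. M r c \<Longrightarrow> r \<in> R \<and> c \<in> C"
    and "R \<noteq> {}" and no: "\<nexists>k r c. special_cycle M k r c"
  obtains r where "r \<in> R" "\<And>c c'. M r c \<Longrightarrow> M r c' \<Longrightarrow> (\<forall>x. M x c \<longrightarrow> M x c') \<or> (\<forall>x. M x c' \<longrightarrow> M x c)"
proof -
  obtain s p where sp: "inj_on s R" "inj_on p C" "s ` R \<subseteq> {..<card R}"
    "doubly_lexical M C s p" "doubly_lexical (\<lambda>c r. M r c) R p s"
    using ex_doubly_lexical[OF fin M] by blast
  have "Min (s ` R) \<in> s ` R" using fin assms(4) by (intro Min_in) auto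
  then obtain r where r: "r \<in> R" "s r = Min (s ` R)" by (metis imageE)
  have nested: "\<forall>x. M x c \<longrightarrow> M x c'" if c: "M r c" "M r c'" "p c < p c'" for c c'
  proof (rule ccontr)
    assume "\<not> ?thesis"
    then obtain x where x: "M x c" "\<not> M x c'" by blast
    then have "x \<in> R" "x \<noteq> r" using M c by auto
    then have "s r \<le> s x" "s r \<noteq> s x" using r fin sp(1) by (auto dest: inj_onD)
    then have lt: "s r < s x" by simp
    have "\<exists>k r c. special_cycle M k r c"
    proof (rule special_cycle_of_induced_path[where L = 1 and r = "\<lambda>i. if i = 0 then r else x"
          and c = "\<lambda>i. if i = 0 then c' else c" and m = "card R" and R = R and C = C and s = s and p = p])
      show "s x < card R \<and> x \<in> R \<and> y \<in> C" if "M x y" for x y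
        using M[OF that] sp(3) by auto
      show "M (if i = 0 then r else x) (if j = 0 then c' else c) \<longleftrightarrow> j = i \<or> j = Suc i"
        if "i \<le> 1" "j \<le> 1" "i \<noteq> 1 \<or> j \<noteq> 0" for i j :: nat
        using that c x by (auto simp: le_Suc_eq)
    qed (use sp x c lt in simp_all)
    then show False using no by blast
  qed
  show ?thesis
  proof (rule that[OF r(1)])
    fix c c' assume c: "M r c" "M r c'"
    have "c = c'" if "p c = p c'"
      using inj_onD[OF sp(2) that] M c by blast
    then show "(\<forall>x. M x c \<longrightarrow> M x c') \<or> (\<forall>x. M x c' \<longrightarrow> M x c)"
      using nested[OF c] nested[OF c(2,1)] by (cases "p c" "p c'" rule: linorder_cases) simp_all
  qed
qed

lemma special_cycle_rotate:
  assumes "special_cycle M k r c"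
  shows "special_cycle M k (\<lambda>i. r ((i + s) mod k)) (\<lambda>i. c ((i + s) mod k))"
  unfolding special_cycle_def
proof (intro conjI allI impI)
  have k: "k \<ge> 3" and M: "\<And>i j. i < k \<Longrightarrow> j < k \<Longrightarrow> M (r i) (c j) \<longleftrightarrow> j = i \<or> j = Suc i mod k"
    using assms by (auto simp: special_cycle_def)
  have cancel: "(j + s) mod k = (i + s) mod k \<longleftrightarrow> j mod k = i mod k" for i j
    by (simp add: cong_def[symmetric] cong_add_rcancel_nat)
  fix i j assume ij: "i < k" "j < k"
  have "M (r ((i + s) mod k)) (c ((j + s) mod k)) \<longleftrightarrow>
      (j + s) mod k = (i + s) mod k \<or> (j + s) mod k = (Suc i + s) mod k"
    using M[of "(i + s) mod k" "(j + s) mod k"] k by (simp add: mod_Suc_eq)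
  then show "M (r ((i + s) mod k)) (c ((j + s) mod k)) \<longleftrightarrow> j = i \<or> j = Suc i mod k"
    using ij by (simp only: cancel mod_less)
qed (use assms in \<open>simp add: special_cycle_def\<close>)

text \<open>Row \<open>x\<close> joins the two ends of the path \<open>c 0, r 0, ..., c g\<close>,
  and the rest of the cycle is dropped.\<close>

lemma special_cycle_shortcut:
  assumes "special_cycle M k r c" and "2 \<le> g" "g + 2 \<le> k"
    and "M x (c 0)" "M x (c g)" "\<And>j. 0 < j \<Longrightarrow> j < g \<Longrightarrow> \<not> M x (c j)"
  shows "special_cycle M (Suc g) (r(g := x)) c"
proof -
  have "M ((r(g := x)) i) (c j) \<longleftrightarrow> j = i \<or> j = Suc i mod Suc g" if "i < Suc g" "j < Suc g" for i j
  proof (cases "i = g")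
    case True
    then show ?thesis using assms(4,5) assms(6)[of j] that by (cases "j = 0 \<or> j = g") auto
  next
    case False
    then show ?thesis using assms(1-3) that by (auto simp: special_cycle_def)
  qed
  then show ?thesis using assms(2) by (simp add: special_cycle_def)
qed

text \<open>Otherwise rotate so that column \<open>0\<close> misses \<open>x\<close>. The arc through \<open>0\<close> from the last to the
  first column in \<open>x\<close> avoids \<open>x\<close> in between, so \<open>x\<close> closes it to a shorter special cycle.\<close>

lemma minimal_special_cycle_chord:
  assumes cyc: "special_cycle M k r c"
    and min: "\<And>k' r' c'. special_cycle M k' r' c' \<Longrightarrow> k \<le> k'"
    and ij: "i < k" "j < k" "M x (c i)" "M x (c j)" "i \<noteq> j" "j \<noteq> Suc i mod k" "i \<noteq> Suc j mod k"
    and l: "l < k"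
  shows "M x (c l)"
proof (rule ccontr)
  assume nl: "\<not> M x (c l)"
  have k: "k \<ge> 3" using cyc by (simp add: special_cycle_def)
  \<comment> \<open>Position \<open>0\<close> now carries column \<open>c l\<close>, so that
    \<open>0\<close> is not in \<open>T\<close>.\<close>
  define d where "d = (\<lambda>n. c ((n + l) mod k))"
  define T where "T = {n. n < k \<and> M x (d n)}"
  have shift: "\<exists>n<k. (n + l) mod k = m" if "m < k" for m
    using that l by (intro exI[of _ "if m < l then m + k - l else m - l"]) (auto simp: algebra_simps)
  obtain i' j' where ij': "i' < k" "(i' + l) mod k = i" "j' < k" "(j' + l) mod k = j"
    using shift ij by meson
  then have inT: "i' \<in> T" "j' \<in> T" using ij by (auto simp: T_def d_def)
  have "Suc i mod k = (Suc i' + l) mod k" "Suc j mod k = (Suc j' + l) mod k"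
    unfolding ij'(2,4)[symmetric] by (simp_all add: mod_Suc_eq)
  then have "Suc i' \<noteq> j'" "Suc j' \<noteq> i'" "i' \<noteq> j'"
    using ij' ij by metis+
  moreover have fT: "finite T" by (simp add: T_def)
  \<comment> \<open>The two given positions are distinct and not consecutive, hence at least 2
    apart.\<close>
  ultimately have gap: "Max T \<ge> Min T + 2"
    using Min_le[OF fT inT(1)] Min_le[OF fT inT(2)] Max_ge[OF fT inT(1)] Max_ge[OF fT inT(2)] by linarith
  have mT: "Min T \<in> T" "Max T \<in> T" using fT inT by (auto intro!: Min_in Max_in)
  have "0 \<notin> T" using nl l by (simp add: T_def d_def)
  then have "Min T \<noteq> 0" using mT(1) by metis
  then have p: "Min T \<ge> 1" "Max T < k" using mT(2) by (simp_all add: T_def)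
  \<comment> \<open>The number of steps from \<open>Max T\<close> through \<open>0\<close> to
    \<open>Min T\<close>; \<open>e\<close> renumbers the columns so that this arc starts at
    \<open>0\<close>.\<close>
  define g where "g = k - Max T + Min T"
  define e where "e = (\<lambda>n. d ((n + Max T) mod k))"
  have e: "special_cycle M k (\<lambda>n. r (((n + Max T) mod k + l) mod k)) e"
    unfolding e_def d_def by (rule special_cycle_rotate[OF special_cycle_rotate[OF cyc]])
  have "special_cycle M (Suc g) ((\<lambda>n. r (((n + Max T) mod k + l) mod k))(g := x)) e"
  proof (rule special_cycle_shortcut[OF e])
    show "2 \<le> g" "g + 2 \<le> k" using p gap by (auto simp: g_def)
    show "M x (e 0)" using mT p by (simp add: e_def T_def)
    have "(g + Max T) mod k = Min T" using p gap by (simp add: g_def)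
    then show "M x (e g)" using mT by (simp add: e_def T_def)
    show "\<not> M x (e n)" if n: "0 < n" "n < g" for n
    proof
      assume "M x (e n)"
      then have "(n + Max T) mod k \<in> T" using k by (simp add: e_def T_def)
      then have "Min T \<le> (n + Max T) mod k" "(n + Max T) mod k \<le> Max T"
        using fT by auto
      moreover have "(n + Max T) mod k = (if n + Max T < k then n + Max T else n + Max T - k)"
      proof (cases "n + Max T < k")
        case False
        then have "n + Max T - k < k" using n p gap by (simp add: g_def)
        then show ?thesis using False by (simp add: le_mod_geq)
      qed simp
      ultimately show False using n p by (simp add: g_def split: if_splits)
    qed
  qed
  from min[OF this] show False using p gap by (simp add: g_def)
qed

section \<open>Holes and suns from special cycles\<close>

lemma contains_inducedI:
  fixes f :: "'b \<Rightarrow> 'a"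
  assumes G: "pair_graph G" and F: "pair_wf_digraph F"
    and f: "inj_on f (pverts F)" "f ` pverts F \<subseteq> pverts G"
    and E: "\<And>a b. a \<in> pverts F \<Longrightarrow> b \<in> pverts F \<Longrightarrow> (f a, f b) \<in> parcs G \<longleftrightarrow> (a, b) \<in> parcs F"
  shows "contains_induced G F"
proof -
  interpret pair_graph G by fact
  interpret F: pair_wf_digraph F by fact
  let ?H = "with_proj G \<restriction> (f ` pverts F)"
  \<comment> \<open>\<open>digraph_iso\<close> maps the subgraph onto \<open>F\<close>, so the
    isomorphism is built from the inverse of \<open>f\<close>.\<close>
  define g where "g = the_inv_into (pverts F) f"
  have g: "g (f a) = a" if "a \<in> pverts F" for a
    using that f by (simp add: g_def the_inv_into_f_f)
  define h where "h = \<lparr>iso_verts = g, iso_arcs = map_prod g g, iso_head = snd, iso_tail = fst\<rparr>"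
  have arcs: "arcs ?H = map_prod f f ` parcs F"
  proof
    show "arcs ?H \<subseteq> map_prod f f ` parcs F"
    proof
      fix e assume "e \<in> arcs ?H"
      then obtain a b where ab: "e = (f a, f b)" "a \<in> pverts F" "b \<in> pverts F" "(f a, f b) \<in> parcs G"
        by (cases e) auto
      then have "(a, b) \<in> parcs F" using E by blast
      then show "e \<in> map_prod f f ` parcs F" using ab(1) by force
    qed
    show "map_prod f f ` parcs F \<subseteq> arcs ?H"
      using E by (auto dest: F.in_arcsD1 F.in_arcsD2)
  qed
  have garcs: "map_prod g g ` arcs ?H = parcs F"
  proof -
    have "map_prod g g (map_prod f f e) = e" if "e \<in> parcs F" for e
      using that by (cases e) (auto simp: g dest: F.in_arcsD1 F.in_arcsD2)
    then show ?thesis unfolding arcs image_image by simp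
  qed
  have gverts: "g ` f ` pverts F = pverts F"
    unfolding image_image by (simp add: g)
  have ginj: "inj_on g (f ` pverts F)"
    by (rule inj_onI) (auto simp: g)
  have "pre_digraph.digraph_isomorphism ?H h"
    unfolding pre_digraph.digraph_isomorphism_def
  proof (intro conjI)
    show "wf_digraph ?H" by (rule wellformed_induce_subgraph)
    show "inj_on (iso_verts h) (verts ?H)" using ginj by (simp add: h_def)
    have "inj_on (map_prod g g) (f ` pverts F \<times> f ` pverts F)"
      using ginj by (intro map_prod_inj_on)
    then show "inj_on (iso_arcs h) (arcs ?H)"
      unfolding h_def digraph_isomorphism.simps
      by (rule inj_on_subset) auto
  qed (auto simp: h_def)
  moreover have "with_proj F = app_iso h ?H"
    using garcs gverts by (simp add: app_iso_def h_def with_proj_def del: induce_subgraph_arcs)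
  ultimately have "digraph_iso ?H (with_proj F)" unfolding digraph_iso_def by blast
  moreover have "induced_subgraph ?H (with_proj G)" using f(2) by (intro induced_induce) simp
  ultimately show ?thesis unfolding contains_induced_def by blast
qed

lemma has_holeI:
  assumes G: "pair_graph G" and k: "k \<ge> 4"
    and c: "inj_on c {0..<k}" "c ` {0..<k} \<subseteq> pverts G"
    and E: "\<And>i j. i < k \<Longrightarrow> j < k \<Longrightarrow> (c i, c j) \<in> parcs G \<longleftrightarrow> j = Suc i mod k \<or> i = Suc j mod k"
  shows "has_hole G"
proof -
  interpret C: pair_graph "cycle_graph k" using k by (intro pair_graph_cycle_graph) simp
  have "contains_induced G (cycle_graph k)"
  proof (rule contains_inducedI[where f = c, OF G C.pair_wf_digraph])
    show "(c i, c j) \<in> parcs G \<longleftrightarrow> (i, j) \<in> parcs (cycle_graph k)"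
      if "i \<in> pverts (cycle_graph k)" "j \<in> pverts (cycle_graph k)" for i j
      using E[of i j] that by (simp add: cycle_graph_def)
  qed (use c in \<open>simp_all add: cycle_graph_def\<close>)
  then show ?thesis using k by (auto simp: has_hole_def)
qed

section \<open>Maximal cliques, holes and suns\<close>

context pair_graph begin

lemma four_cycle_chord:
  assumes "\<not> has_hole G"
    and "(a, b) \<in> parcs G" "(b, c) \<in> parcs G" "(c, d) \<in> parcs G" "(d, a) \<in> parcs G"
    and "a \<noteq> c" "b \<noteq> d"
  shows "(a, c) \<in> parcs G \<or> (b, d) \<in> parcs G"
proof (rule ccontr)
  assume n: "\<not> ?thesis"
  have ne: "a \<noteq> b" "b \<noteq> c" "c \<noteq> d" "d \<noteq> a" using assms no_loops' by auto
  have loop: "(x, x) \<notin> parcs G" for x using no_loops' by blast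
  have less4: "i < 4 \<longleftrightarrow> i = 0 \<or> i = 1 \<or> i = 2 \<or> i = 3" for i :: nat by auto
  note E = assms(2-5) assms(2-5)[THEN arcs_symmetric]
  have n': "(c, a) \<notin> parcs G" "(d, b) \<notin> parcs G" "(a, c) \<notin> parcs G" "(b, d) \<notin> parcs G"
    using n arcs_symmetric by blast+
  have "has_hole G"
  proof (rule has_holeI[where k = 4 and c = "\<lambda>i. if i = 0 then a else if i = 1 then b else if i = 2 then c else d"])
    show "pair_graph G" ..
    fix i j :: nat assume "i < 4" "j < 4"
    then show "((if i = 0 then a else if i = 1 then b else if i = 2 then c else d),
        (if j = 0 then a else if j = 1 then b else if j = 2 then c else d)) \<in> parcs G
        \<longleftrightarrow> j = Suc i mod 4 \<or> i = Suc j mod 4"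
      unfolding less4 using E n' loop by (elim disjE) simp_all
  qed (use ne assms(6,7) E in \<open>auto simp: inj_on_def dest: in_arcsD1\<close>)
  then show False using assms(1) by simp
qed

definition max_clique :: "'a set \<Rightarrow> bool" where
  "max_clique K \<longleftrightarrow> K \<subseteq> pverts G \<and> (\<forall>x\<in>K. \<forall>y\<in>K. x \<noteq> y \<longrightarrow> (x, y) \<in> parcs G) \<and>
     (\<forall>x\<in>pverts G - K. \<exists>y\<in>K. (x, y) \<notin> parcs G)"

lemma ex_max_clique:
  assumes "C \<subseteq> pverts G" "\<forall>x\<in>C. \<forall>y\<in>C. x \<noteq> y \<longrightarrow> (x, y) \<in> parcs G"
  obtains K where "max_clique K" "C \<subseteq> K"
proof -
  let ?A = "{K. K \<subseteq> pverts G \<and> (\<forall>x\<in>K. \<forall>y\<in>K. x \<noteq> y \<longrightarrow> (x, y) \<in> parcs G)}"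
  have "finite ?A" using pair_finite_verts by (intro finite_subset[of ?A "Pow (pverts G)"]) auto
  then obtain K where K: "K \<in> ?A" "C \<subseteq> K" "\<And>L. L \<in> ?A \<Longrightarrow> K \<subseteq> L \<Longrightarrow> K = L"
    using finite_has_maximal2[of ?A C] assms by auto
  have "\<exists>y\<in>K. (x, y) \<notin> parcs G" if "x \<in> pverts G - K" for x
  proof (rule ccontr)
    assume "\<not> ?thesis"
    then have "insert x K \<in> ?A" using K(1) that arcs_symmetric by auto
    then show False using K(3)[of "insert x K"] that by auto
  qed
  then show ?thesis using that[of K] K by (simp add: max_clique_def)
qed

text \<open>Without induced 4-cycles the neighbourhoods in \<open>D\<close> of the vertices of \<open>A\<close> form a chain; a
  vertex in the least of them would be adjacent to all of \<open>A\<close>.\<close>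

lemma max_clique_private_vertex:
  assumes "\<not> has_hole G" and A: "max_clique A" "A \<noteq> {}"
    and D: "D \<subseteq> pverts G" "\<forall>x\<in>D. \<forall>y\<in>D. x \<noteq> y \<longrightarrow> (x, y) \<in> parcs G" "D \<inter> A = {}"
  obtains b where "b \<in> A" "\<And>d. d \<in> D \<Longrightarrow> (b, d) \<notin> parcs G"
proof -
  define N where "N = (\<lambda>b. {d \<in> D. (b, d) \<in> parcs G})"
  have fN: "finite (N b)" for b
    using D(1) pair_finite_verts by (auto simp: N_def intro: finite_subset)
  obtain b where b: "b \<in> A" "\<And>y. y \<in> A \<Longrightarrow> card (N b) \<le> card (N y)"
    using A(2) ex_has_least_nat[of "\<lambda>b. b \<in> A" _ "\<lambda>b. card (N b)"] by blast
  have "(b, d) \<notin> parcs G" if d: "d \<in> D" for d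
  proof
    assume bd: "(b, d) \<in> parcs G"
    obtain b' where b': "b' \<in> A" "(d, b') \<notin> parcs G"
      using A(1) D d unfolding max_clique_def by blast
    have "d \<in> N b" "d \<notin> N b'" using d bd b' arcs_symmetric by (auto simp: N_def)
    then have "\<not> N b' \<subseteq> N b"
      using b(2)[OF b'(1)] psubset_card_mono[OF fN, of "N b'" b] by force
    then obtain d' where d': "d' \<in> D" "(b', d') \<in> parcs G" "(b, d') \<notin> parcs G" by (auto simp: N_def)
    have ne: "d \<noteq> d'" "b \<noteq> b'" "d \<noteq> b'" "b \<noteq> d'" using bd d' d b b' D(3) by auto
    have "(d, d') \<in> parcs G" "(b', b) \<in> parcs G"
      using D(2) d d' ne b b' A(1) by (auto simp: max_clique_def)
    then have "(b, d') \<in> parcs G \<or> (d, b') \<in> parcs G"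
      using four_cycle_chord[OF assms(1) bd _ arcs_symmetric[OF d'(2)]] ne by blast
    then show False using d'(3) b'(2) by blast
  qed
  then show ?thesis by (rule that[OF b(1)])
qed

text \<open>Take a shortest special cycle; consecutive columns share a clique. If some other pair is
  adjacent, a maximal clique through it must contain all columns. If none is, the columns form a
  hole, except for \<open>k = 3\<close>, where all pairs are consecutive.\<close>

lemma hole_or_clique_special_cycle:
  assumes "\<not> has_hole G" and ex: "special_cycle (\<lambda>K v. max_clique K \<and> v \<in> K) k0 r0 c0"
  obtains k r c where "special_cycle (\<lambda>K v. max_clique K \<and> v \<in> K) k r c" "inj_on c {0..<k}"
    "\<And>i j. i < k \<Longrightarrow> j < k \<Longrightarrow> i \<noteq> j \<Longrightarrow> (c i, c j) \<in> parcs G"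
proof -
  let ?M = "\<lambda>K v. max_clique K \<and> v \<in> K"
  define k where "k = (LEAST k. \<exists>r c. special_cycle ?M k r c)"
  have "\<exists>r c. special_cycle ?M k r c" unfolding k_def by (rule LeastI[of _ k0]) (use ex in blast)
  then obtain r c where cyc: "special_cycle ?M k r c" by blast
  have min: "k \<le> k'" if "special_cycle ?M k' r' c'" for k' r' c'
    unfolding k_def by (rule Least_le) (use that in blast)
  have k: "k \<ge> 3" and M: "\<And>i j. i < k \<Longrightarrow> j < k \<Longrightarrow> ?M (r i) (c j) \<longleftrightarrow> j = i \<or> j = Suc i mod k"
    using cyc by (auto simp: special_cycle_def)
  have r: "max_clique (r i)" if "i < k" for i using M[of i i] that by simp
  have V: "c i \<in> pverts G" if "i < k" for i using M[of i i] that by (auto simp: max_clique_def)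
  have inj: "inj_on c {0..<k}"
  \<comment> \<open>Equal columns lie in each other's rows, so distinct indices would be successors
    of each other, which \<open>k \<ge> 3\<close> excludes.\<close>
  proof (rule inj_onI)
    fix i j assume ij: "i \<in> {0..<k}" "j \<in> {0..<k}" "c i = c j"
    then have "j = i \<or> j = Suc i mod k" "i = j \<or> i = Suc j mod k"
      using M[of i i] M[of i j] M[of j j] M[of j i] by auto
    then show "i = j" using ij k by (auto simp: mod_Suc split: if_splits)
  qed
  have consec: "(c i, c (Suc i mod k)) \<in> parcs G" if "i < k" for i
  proof -
    have s: "Suc i mod k < k" "Suc i mod k \<noteq> i" using k that by (auto simp: mod_Suc)
    then have "c i \<noteq> c (Suc i mod k)" using inj that by (auto dest: inj_onD)
    moreover have "c i \<in> r i" "c (Suc i mod k) \<in> r i" using M[of i i] M[OF that s(1)] that by auto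
    ultimately show ?thesis using r[OF that] by (auto simp: max_clique_def)
  qed
  have "(c i, c j) \<in> parcs G" if ij: "i < k" "j < k" "i \<noteq> j" for i j
  proof (cases "\<exists>a<k. \<exists>b<k. a \<noteq> b \<and> b \<noteq> Suc a mod k \<and> a \<noteq> Suc b mod k \<and> (c a, c b) \<in> parcs G")
    case True
    then obtain a b where ab: "a < k" "b < k" "a \<noteq> b" "b \<noteq> Suc a mod k" "a \<noteq> Suc b mod k"
      "(c a, c b) \<in> parcs G" by blast
    obtain K where K: "max_clique K" "{c a, c b} \<subseteq> K"
      using ex_max_clique[of "{c a, c b}"] ab V arcs_symmetric by auto
    have "?M K (c l)" if "l < k" for l
      using minimal_special_cycle_chord[where M = ?M and x = K, OF cyc min ab(1,2) _ _ ab(3-5) that] K by simp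
    then have "c i \<in> K" "c j \<in> K" using ij by auto
    moreover have "c i \<noteq> c j" using inj ij by (auto dest: inj_onD)
    ultimately show ?thesis using K by (auto simp: max_clique_def)
  next
    case no_chord: False
    show ?thesis
    proof (cases "k \<ge> 4")
      case True
      have "has_hole G"
      proof (rule has_holeI[OF _ True inj])
        show "(c i, c j) \<in> parcs G \<longleftrightarrow> j = Suc i mod k \<or> i = Suc j mod k" if "i < k" "j < k" for i j
        proof
          assume "(c i, c j) \<in> parcs G"
          moreover from this have "i \<noteq> j" using no_loops' by blast
          ultimately show "j = Suc i mod k \<or> i = Suc j mod k" using that no_chord by blast
        next
          assume "j = Suc i mod k \<or> i = Suc j mod k"
          then show "(c i, c j) \<in> parcs G"
            using consec[OF that(1)] arcs_symmetric[OF consec[OF that(2)]] by blast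
        qed
      qed (use V pair_graph in auto)
      then show ?thesis using assms(1) by simp
    next
      case False
      then have "j = Suc i mod k \<or> i = Suc j mod k"
        using k ij by (auto simp: mod_Suc split: if_splits)
      then show ?thesis using consec[OF ij(1)] arcs_symmetric[OF consec[OF ij(2)]] by blast
    qed
  qed
  then show ?thesis by (rule that[OF cyc inj])
qed

text \<open>The sun is indexed from \<open>1\<close> to \<open>k\<close>, special cycles from
  \<open>0\<close> to \<open>k - 1\<close>. Reduction modulo \<open>k\<close>, sending
  \<open>k\<close> to \<open>0\<close>, matches the two and respects cyclic successors.\<close>

lemma contains_sunI:
  assumes k: "k \<ge> 3"
    and inj: "inj_on a {0..<k}" "inj_on b {0..<k}" and V: "\<And>i. i < k \<Longrightarrow> a i \<in> pverts G \<and> b i \<in> pverts G"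
    and ne: "\<And>i j. i < k \<Longrightarrow> j < k \<Longrightarrow> a i \<noteq> b j"
    and aa: "\<And>i j. i < k \<Longrightarrow> j < k \<Longrightarrow> i \<noteq> j \<Longrightarrow> (a i, a j) \<in> parcs G"
    and bb: "\<And>i j. i < k \<Longrightarrow> j < k \<Longrightarrow> i \<noteq> j \<Longrightarrow> (b i, b j) \<notin> parcs G"
    and ab: "\<And>i j. i < k \<Longrightarrow> j < k \<Longrightarrow> (b j, a i) \<in> parcs G \<longleftrightarrow> i = j \<or> i = Suc j mod k"
  shows "contains_induced G (sun_graph k)"
proof -
  interpret S: pair_graph "sun_graph k" by (rule pair_graph_sun_graph)
  let ?f = "case_sum (\<lambda>i. a (i mod k)) (\<lambda>i. b (i mod k))"
  have m: "i mod k < k" for i using k by simp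
  have mi: "i mod k = j mod k \<longleftrightarrow> i = j" if "i \<in> {1..k}" "j \<in> {1..k}" for i j
    using that by (cases "i = k"; cases "j = k") auto
  have sun: "i mod k = Suc (j mod k) mod k \<longleftrightarrow> [i = j + 1] (mod k)" for i j
    by (simp add: cong_def mod_Suc_eq)
  have ab': "(b (j mod k), a (i mod k)) \<in> parcs G \<longleftrightarrow> sun_adj k i j"
    "(a (i mod k), b (j mod k)) \<in> parcs G \<longleftrightarrow> sun_adj k i j"
    if "i \<in> {1..k}" "j \<in> {1..k}" for i j
  proof -
    show "(b (j mod k), a (i mod k)) \<in> parcs G \<longleftrightarrow> sun_adj k i j"
      unfolding ab[OF m m] mi[OF that] sun sun_adj_def ..
    then show "(a (i mod k), b (j mod k)) \<in> parcs G \<longleftrightarrow> sun_adj k i j"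
      using arcs_symmetric by blast
  qed
  have aa': "(a (i mod k), a (j mod k)) \<in> parcs G \<longleftrightarrow> i \<noteq> j" if "i \<in> {1..k}" "j \<in> {1..k}" for i j
    using aa[OF m m, of i j] mi[OF that] no_loops' by auto
  have bb': "(b (i mod k), b (j mod k)) \<notin> parcs G" if "i \<in> {1..k}" "j \<in> {1..k}" for i j
    using bb[OF m m, of i j] mi[OF that] no_loops' by auto
  show ?thesis
  proof (rule contains_inducedI[OF pair_graph S.pair_wf_digraph, of ?f])
    have "a (i mod k) = a (j mod k) \<longleftrightarrow> i = j" "b (i mod k) = b (j mod k) \<longleftrightarrow> i = j"
      if "i \<in> {1..k}" "j \<in> {1..k}" for i j
      using inj_on_eq_iff[OF inj(1), of "i mod k" "j mod k"] inj_on_eq_iff[OF inj(2), of "i mod k" "j mod k"]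
        m mi[OF that] by auto
    then show "inj_on ?f (pverts (sun_graph k))"
      using ne[OF m m] ne[OF m m, symmetric] by (auto simp: inj_on_def sun_graph_def)
    show "?f ` pverts (sun_graph k) \<subseteq> pverts G"
      using V[OF m] by (auto simp: sun_graph_def)
    show "(?f x, ?f y) \<in> parcs G \<longleftrightarrow> (x, y) \<in> parcs (sun_graph k)"
      if "x \<in> pverts (sun_graph k)" "y \<in> pverts (sun_graph k)" for x y
      using that by (cases x; cases y) (auto simp: sun_graph_def ab' aa' bb')
  qed
qed

text \<open>The columns of a shortest special cycle are the central clique. Each row
  \<open>r i\<close> supplies an outer vertex \<open>b i\<close> whose only neighbours among the
  columns are the two columns in that row. Adjacent outer vertices would lie on an induced
  4-cycle.\<close>

lemma special_cycle_hole_or_sun: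
  assumes "special_cycle (\<lambda>K v. max_clique K \<and> v \<in> K) k0 r0 c0"
  shows "has_hole G \<or> (\<exists>k\<ge>3. contains_induced G (sun_graph k))"
proof (rule ccontr)
  assume neg: "\<not> ?thesis"
  then have nh: "\<not> has_hole G" by simp
  obtain k r c where cyc: "special_cycle (\<lambda>K v. max_clique K \<and> v \<in> K) k r c" and inj: "inj_on c {0..<k}"
    and clq: "\<And>i j. i < k \<Longrightarrow> j < k \<Longrightarrow> i \<noteq> j \<Longrightarrow> (c i, c j) \<in> parcs G"
    using hole_or_clique_special_cycle[OF nh assms] by blast
  have k: "k \<ge> 3" and M: "\<And>i j. i < k \<Longrightarrow> j < k \<Longrightarrow> max_clique (r i) \<and> c j \<in> r i \<longleftrightarrow> j = i \<or> j = Suc i mod k"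
    using cyc by (auto simp: special_cycle_def)
  have r: "max_clique (r i)" if "i < k" for i using M[of i i] that by simp
  then have M: "c j \<in> r i \<longleftrightarrow> j = i \<or> j = Suc i mod k" if "i < k" "j < k" for i j
    using M[OF that] that by simp
  have V: "c i \<in> pverts G" if "i < k" for i using M[of i i] r[of i] that by (auto simp: max_clique_def)
  have "\<exists>b\<in>r i. \<forall>j<k. j \<noteq> i \<and> j \<noteq> Suc i mod k \<longrightarrow> (b, c j) \<notin> parcs G" if i: "i < k" for i
  proof -
    let ?D = "c ` {j. j < k \<and> j \<noteq> i \<and> j \<noteq> Suc i mod k}"
    obtain b where "b \<in> r i" "\<And>d. d \<in> ?D \<Longrightarrow> (b, d) \<notin> parcs G"
    proof (rule max_clique_private_vertex[OF nh r[OF i], where D = ?D])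
      show "r i \<noteq> {}" using M[of i i] i by auto
      show "\<forall>x\<in>?D. \<forall>y\<in>?D. x \<noteq> y \<longrightarrow> (x, y) \<in> parcs G"
        using clq by auto
    qed (use V M i in auto)
    then show ?thesis by blast
  qed
  then obtain b where b: "\<And>i. i < k \<Longrightarrow> b i \<in> r i"
    and bn: "\<And>i j. i < k \<Longrightarrow> j < k \<Longrightarrow> j \<noteq> i \<Longrightarrow> j \<noteq> Suc i mod k \<Longrightarrow> (b i, c j) \<notin> parcs G"
    by metis
  have bV: "b i \<in> pverts G" if "i < k" for i using b[OF that] r[OF that] by (auto simp: max_clique_def)
  have bc: "c j \<noteq> b i" if ij: "i < k" "j < k" for i j
  proof
    assume eq: "c j = b i"
    then have j: "j = i \<or> j = Suc i mod k" using M[OF ij] b[OF ij(1)] by simp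
    \<comment> \<open>By \<open>k \<ge> 3\<close> this index lies outside row \<open>r i\<close>:
      \<open>c j\<close> is adjacent to its column and \<open>b i\<close> is not.\<close>
    let ?m = "Suc (Suc i mod k) mod k"
    have m: "?m < k" "?m \<noteq> i" "?m \<noteq> Suc i mod k" using k ij by (auto simp: mod_Suc)
    have "?m \<noteq> j" using j m by blast
    then have "(c j, c ?m) \<in> parcs G" using clq[OF ij(2) m(1)] by blast
    then show False using bn[OF ij(1) m] eq by simp
  qed
  have adj: "(b j, c i) \<in> parcs G \<longleftrightarrow> i = j \<or> i = Suc j mod k" if ij: "i < k" "j < k" for i j
  proof
    assume "i = j \<or> i = Suc j mod k"
    then have "c i \<in> r j" using M ij by blast
    then show "(b j, c i) \<in> parcs G"
      using b[OF ij(2)] r[OF ij(2)] bc[OF ij(2,1)] by (simp add: max_clique_def)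
  qed (use bn ij in blast)
  \<comment> \<open>For \<open>k \<ge> 3\<close> two distinct cyclic pairs \<open>i, i + 1\<close>
    and \<open>j, j + 1\<close> each have a member outside the other.\<close>
  have sep: "\<exists>p q. p < k \<and> q < k \<and> p \<noteq> q \<and> (p = i \<or> p = Suc i mod k) \<and> (q = j \<or> q = Suc j mod k) \<and>
      p \<noteq> j \<and> p \<noteq> Suc j mod k \<and> q \<noteq> i \<and> q \<noteq> Suc i mod k" if ij: "i < k" "j < k" "i \<noteq> j" for i j
  proof -
    consider "j = Suc i mod k" | "i = Suc j mod k" | "j \<noteq> Suc i mod k" "i \<noteq> Suc j mod k" by blast
    then show ?thesis
    proof cases
      case 1
      then show ?thesis using ij k by (intro exI[of _ i] exI[of _ "Suc j mod k"]) (auto simp: mod_Suc)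
    next
      case 2
      then show ?thesis using ij k by (intro exI[of _ "Suc i mod k"] exI[of _ j]) (auto simp: mod_Suc)
    next
      case 3
      then show ?thesis using ij by (intro exI[of _ i] exI[of _ j]) auto
    qed
  qed
  have "contains_induced G (sun_graph k)"
  proof (rule contains_sunI[OF k inj])
    show "inj_on b {0..<k}"
    proof (rule inj_onI, rule ccontr)
      fix i j assume "i \<in> {0..<k}" "j \<in> {0..<k}" and eq: "b i = b j" "i \<noteq> j"
      then have ij: "i < k" "j < k" by auto
      obtain p where "p < k" "p = i \<or> p = Suc i mod k" "p \<noteq> j" "p \<noteq> Suc j mod k"
        using sep[OF ij eq(2)] by blast
      then show False using adj[of p i] adj[of p j] ij eq(1) by simp
    qed
    show "(b i, b j) \<notin> parcs G" if ij: "i < k" "j < k" "i \<noteq> j" for i j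
    proof
      assume e: "(b i, b j) \<in> parcs G"
      obtain p q where pq: "p < k" "q < k" "p \<noteq> q" "p = i \<or> p = Suc i mod k" "q = j \<or> q = Suc j mod k"
        "p \<noteq> j" "p \<noteq> Suc j mod k" "q \<noteq> i" "q \<noteq> Suc i mod k" using sep[OF ij] by blast
      have 1: "(b j, c q) \<in> parcs G" "(c p, b i) \<in> parcs G"
        using adj[OF pq(2) ij(2)] adj[OF pq(1) ij(1)] arcs_symmetric pq(4,5) by blast+
      have 2: "(c q, c p) \<in> parcs G" using clq[OF pq(2,1)] pq(3) by blast
      \<comment> \<open>These are the two possible chords of the cycle
        \<open>b i, b j, c q, c p\<close>.\<close>
      have "(b i, c q) \<notin> parcs G" "(b j, c p) \<notin> parcs G"
        using adj[OF pq(2) ij(1)] adj[OF pq(1) ij(2)] pq(6-9) by blast+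
      then show False
        using four_cycle_chord[OF nh e 1(1) 2 1(2)] bc[OF ij(1) pq(2)] bc[OF ij(2) pq(1)] by metis
    qed
  qed (use V bV bc clq adj in auto)
  then show False using neg k by blast
qed

text \<open>A row of the maximal-clique incidence matrix whose columns are nested is a clique \<open>K\<close>
  whose least column \<open>v\<close> is simplicial and whose greatest column \<open>u\<close> is a maximum neighbour.\<close>

lemma ex_simplicial_maximum_neighbour:
  assumes "\<not> has_hole G" "\<nexists>k. k \<ge> 3 \<and> contains_induced G (sun_graph k)" "pverts G \<noteq> {}"
  obtains v K u where "v \<in> K" "u \<in> K" "K \<subseteq> pverts G" "\<forall>x\<in>K. \<forall>y\<in>K. x \<noteq> y \<longrightarrow> (x, y) \<in> parcs G"
    "\<forall>w. (v, w) \<in> parcs G \<longrightarrow> w \<in> K"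
    "\<forall>x\<in>K. \<forall>w. (x, w) \<in> parcs G \<longrightarrow> w = u \<or> (u, w) \<in> parcs G"
proof -
  let ?M = "\<lambda>K v. max_clique K \<and> v \<in> K"
  have fin: "finite {K. max_clique K}"
    by (rule finite_subset[of _ "Pow (pverts G)"]) (use pair_finite_verts in \<open>auto simp: max_clique_def\<close>)
  obtain K0 where "max_clique K0" by (rule ex_max_clique[of "{}"]) simp_all
  then have ne: "{K. max_clique K} \<noteq> {}" by blast
  have no: "\<nexists>k r c. special_cycle ?M k r c"
  proof
    assume "\<exists>k r c. special_cycle ?M k r c"
    then obtain k r c where "special_cycle ?M k r c" by blast
    from special_cycle_hole_or_sun[OF this] show False using assms(1,2) by blast
  qed
  have M: "K \<in> {K. max_clique K} \<and> v \<in> pverts G" if "?M K v" for K v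
    using that by (auto simp: max_clique_def)
  obtain K where "K \<in> {K. max_clique K}"
    and nest: "\<And>x y. ?M K x \<Longrightarrow> ?M K y \<Longrightarrow> (\<forall>L. ?M L x \<longrightarrow> ?M L y) \<or> (\<forall>L. ?M L y \<longrightarrow> ?M L x)"
    by (rule ex_nested_row[of "{K. max_clique K}" "pverts G" ?M, OF fin pair_finite_verts M ne no]) (assumption | blast)+
  then have K: "max_clique K" by simp
  define Q where "Q = (\<lambda>x. {L. ?M L x})"
  have fK: "finite K" using K pair_finite_verts by (auto simp: max_clique_def intro: finite_subset)
  have "K \<noteq> {}" using K assms(3) by (auto simp: max_clique_def)
  then have fQ: "finite (Q ` K)" "Q ` K \<noteq> {}" using fK by auto
  \<comment> \<open>Minimal and maximal members suffice, because \<open>chain\<close> makes them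
    least and greatest.\<close>
  obtain v where v: "v \<in> K" "\<And>x. x \<in> K \<Longrightarrow> Q x \<subseteq> Q v \<Longrightarrow> Q v = Q x"
    using finite_has_minimal[OF fQ] by auto
  obtain u where u: "u \<in> K" "\<And>x. x \<in> K \<Longrightarrow> Q u \<subseteq> Q x \<Longrightarrow> Q u = Q x"
    using finite_has_maximal[OF fQ] by auto
  have chain: "Q x \<subseteq> Q y \<or> Q y \<subseteq> Q x" if "x \<in> K" "y \<in> K" for x y
    using nest[of x y] K that unfolding Q_def by blast
  have Qv: "Q v \<subseteq> Q x" and Qu: "Q x \<subseteq> Q u" if "x \<in> K" for x
    using chain[OF that v(1)] v(2)[OF that] chain[OF that u(1)] u(2)[OF that] by auto
  have edge: "\<exists>L. max_clique L \<and> x \<in> L \<and> w \<in> L" if xw: "(x, w) \<in> parcs G" for x w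
  proof -
    obtain L where "max_clique L" "{x, w} \<subseteq> L"
      using ex_max_clique[of "{x, w}"] xw arcs_symmetric in_arcsD1 in_arcsD2 by auto
    then show ?thesis by auto
  qed
  \<comment> \<open>Every maximal clique through \<open>v\<close> contains \<open>K\<close>, so a
    neighbour of \<open>v\<close> outside \<open>K\<close> would be adjacent to all of
    \<open>K\<close>, against maximality.\<close>
  have simplicial: "w \<in> K" if vw: "(v, w) \<in> parcs G" for w
  proof -
    obtain L where L: "max_clique L" "v \<in> L" "w \<in> L" using edge[OF vw] by blast
    then have KL: "K \<subseteq> L" using Qv unfolding Q_def by blast
    show ?thesis
    proof (rule ccontr)
      assume "w \<notin> K"
      moreover have "w \<in> pverts G" using in_arcsD2[OF vw] .
      ultimately have "\<exists>y\<in>K. (w, y) \<notin> parcs G"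
        using K by (simp add: max_clique_def)
      then obtain y where y: "y \<in> K" "(w, y) \<notin> parcs G" by blast
      then have "y \<in> L" "w \<noteq> y" using KL \<open>w \<notin> K\<close> by auto
      then show False using L y(2) by (simp add: max_clique_def)
    qed
  qed
  have maximum: "w = u \<or> (u, w) \<in> parcs G" if xw: "x \<in> K" "(x, w) \<in> parcs G" for x w
  proof -
    obtain L where "max_clique L" "x \<in> L" "w \<in> L" using edge[OF xw(2)] by blast
    moreover from this have "u \<in> L" using Qu[OF xw(1)] unfolding Q_def by blast
    ultimately show ?thesis by (auto simp: max_clique_def)
  qed
  show ?thesis
    by (rule that[OF v(1) u(1)]) (use K simplicial maximum in \<open>auto simp: max_clique_def\<close>)
qed

end

section \<open>Components and toughness\<close>

text \<open>Connectivity as a relation, so that deleting vertices shrinks \<open>W\<close> and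
  deleting an edge shrinks \<open>E\<close>. It is reflexive even outside \<open>W\<close>, which is
  why \<open>ncomp\<close> counts only classes of points of \<open>W\<close>.\<close>

definition connected_in :: "'a set \<Rightarrow> 'a rel \<Rightarrow> 'a rel" where
  "connected_in W E = (E \<inter> W \<times> W)\<^sup>*"

definition ncomp :: "'a set \<Rightarrow> 'a rel \<Rightarrow> nat" where
  "ncomp W E = card ((\<lambda>a. connected_in W E `` {a}) ` W)"

lemma connected_in_sym:
  assumes "sym E" "(a, b) \<in> connected_in W E"
  shows "(b, a) \<in> connected_in W E"
proof -
  have "sym (E \<inter> W \<times> W)" using assms(1) by (auto simp: sym_def)
  from symD[OF sym_rtrancl[OF this]] show ?thesis using assms(2) unfolding connected_in_def .
qed

lemma connected_in_component_eq_iff: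
  assumes "sym E"
  shows "connected_in W E `` {a} = connected_in W E `` {b} \<longleftrightarrow> (a, b) \<in> connected_in W E"
proof
  assume "connected_in W E `` {a} = connected_in W E `` {b}"
  moreover have "b \<in> connected_in W E `` {b}" by (simp add: connected_in_def)
  ultimately show "(a, b) \<in> connected_in W E" by blast
next
  have tr: "connected_in W E `` {y} \<subseteq> connected_in W E `` {x}" if "(x, y) \<in> connected_in W E" for x y
    using that unfolding connected_in_def by (auto intro: rtrancl_trans)
  assume "(a, b) \<in> connected_in W E"
  then show "connected_in W E `` {a} = connected_in W E `` {b}"
    using tr[of a b] tr[of b a] connected_in_sym[OF assms, of a b W] by auto
qed

lemma connected_in_closed:
  assumes "(a, b) \<in> connected_in W E" "a \<in> A"
    and "\<And>x y. x \<in> A \<Longrightarrow> y \<in> W \<Longrightarrow> (x, y) \<in> E \<Longrightarrow> y \<in> A"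
  shows "b \<in> A"
  using assms(1,2) unfolding connected_in_def
  by (induction rule: rtrancl_induct) (use assms(3) in blast)+

lemma ncomp_gt_1I:
  assumes "finite W" "sym E" "a \<in> W" "b \<in> W" "(a, b) \<notin> connected_in W E"
  shows "ncomp W E > 1"
proof -
  let ?C = "\<lambda>a. connected_in W E `` {a}"
  have "?C a \<noteq> ?C b" using assms by (simp add: connected_in_component_eq_iff)
  then have "card {?C a, ?C b} = 2" by simp
  moreover have "card {?C a, ?C b} \<le> card (?C ` W)"
    using assms by (intro card_mono) auto
  ultimately show ?thesis by (simp add: ncomp_def)
qed

text \<open>By \<open>conn\<close>, sending the class of a point of \<open>X\<close> in
  \<open>W'\<close> to its class in \<open>W\<close> is well defined, and it reaches every class
  counted on the left.\<close>

lemma card_components_le_ncomp: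
  assumes fin: "finite W'" and sub: "X \<subseteq> W'" and sym: "sym E" "sym E'"
    and conn: "\<And>a b. a \<in> X \<Longrightarrow> b \<in> X \<Longrightarrow> (a, b) \<in> connected_in W' E' \<Longrightarrow> (a, b) \<in> connected_in W E"
  shows "card ((\<lambda>a. connected_in W E `` {a}) ` X) \<le> ncomp W' E'"
proof -
  let ?C = "\<lambda>a. connected_in W E `` {a}" and ?C' = "\<lambda>a. connected_in W' E' `` {a}"
  define h where "h = (\<lambda>D. ?C (SOME a. a \<in> X \<and> ?C' a = D))"
  have "h (?C' a) = ?C a" if "a \<in> X" for a
  proof -
    define b where "b = (SOME b. b \<in> X \<and> ?C' b = ?C' a)"
    have "b \<in> X \<and> ?C' b = ?C' a"
      unfolding b_def by (rule someI[of _ a]) (simp add: that)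
    then have "?C b = ?C a"
      using conn[of b a] that by (simp add: connected_in_component_eq_iff sym)
    then show "h (?C' a) = ?C a" unfolding h_def b_def .
  qed
  then have "?C ` X = h ` ?C' ` X" unfolding image_image by simp
  also have "card \<dots> \<le> card (?C' ` X)"
    using fin sub by (intro card_image_le) (auto intro: finite_subset)
  also have "\<dots> \<le> ncomp W' E'"
    unfolding ncomp_def using fin sub by (intro card_mono) auto
  finally show ?thesis .
qed

lemma reachable_conv_connected_in:
  "u \<rightarrow>\<^sup>*\<^bsub>H\<^esub> v \<longleftrightarrow> u \<in> verts H \<and> (u, v) \<in> connected_in (verts H) (arcs_ends H)"
proof
  assume "u \<rightarrow>\<^sup>*\<^bsub>H\<^esub> v"
  then show "u \<in> verts H \<and> (u, v) \<in> connected_in (verts H) (arcs_ends H)"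
    unfolding reachable_def connected_in_def
    by (induction rule: rtrancl_on_induct) (auto intro: rtrancl_into_rtrancl)
next
  assume "u \<in> verts H \<and> (u, v) \<in> connected_in (verts H) (arcs_ends H)"
  then have "(u, v) \<in> (arcs_ends H \<inter> verts H \<times> verts H)\<^sup>*" "u \<in> verts H"
    by (auto simp: connected_in_def)
  then show "u \<rightarrow>\<^sup>*\<^bsub>H\<^esub> v"
    unfolding reachable_def
    by (induction rule: rtrancl_induct) (auto intro: rtrancl_on_into_rtrancl_on)
qed

text \<open>Arcs come in both directions, so strong components are the classes of
  \<open>connected_in\<close>.\<close>

lemma num_components_del_verts:
  assumes "pair_graph G"
  shows "\<omega> (del_verts (with_proj G) S) = ncomp (pverts G - S) (parcs G)"
proof -
  interpret pair_graph G by fact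
  let ?W = "pverts G - S"
  let ?H = "del_verts (with_proj G) S"
  interpret H: wf_digraph ?H unfolding del_verts_def by (rule wellformed_induce_subgraph)
  have V: "verts ?H = ?W" by (simp add: del_verts_def)
  have "arcs_ends ?H = parcs G \<inter> ?W \<times> ?W"
    unfolding arcs_ends_def arc_to_ends_def del_verts_def by force
  then have conn: "connected_in ?W (arcs_ends ?H) = connected_in ?W (parcs G)"
    by (simp add: connected_in_def Int_assoc)
  have sym: "sym (parcs G)" using arcs_symmetric by (auto simp: sym_def)
  have "H.scc_of a = connected_in ?W (parcs G) `` {a}" if "a \<in> ?W" for a
  proof -
    have "b \<in> ?W \<and> (b, a) \<in> connected_in ?W (parcs G)" if "(a, b) \<in> connected_in ?W (parcs G)" for b
      using connected_in_closed[OF that \<open>a \<in> ?W\<close>] connected_in_sym[OF sym that] by blast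
    then show ?thesis
      unfolding H.scc_of_def reachable_conv_connected_in V conn
      using \<open>a \<in> ?W\<close> by auto
  qed
  then have "H.scc_of ` ?W = (\<lambda>a. connected_in ?W (parcs G) `` {a}) ` ?W" by (rule image_cong[OF refl])
  then show ?thesis
    unfolding num_components_def H.card_sccs_verts[symmetric] H.sccs_verts_conv_scc_of ncomp_def V by simp
qed

section \<open>Minimal toughness in terms of cut sets\<close>

lemma toughness_real:
  assumes "\<not> complete_digraph (card (pverts G)) (with_proj G)"
  shows "\<tau> (with_proj G) = ereal (GREATEST t. tough t (with_proj G))"
  using assms unfolding toughness_def with_proj_simps by (rule if_not_P)

text \<open>The toughness of \<open>G\<close> and of each \<open>G - e\<close> is below infinity, so
  none of these graphs is complete and \<open>tough_Greatest\<close> applies to all of them.\<close>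

lemma minimally_toughD:
  assumes G: "pair_graph G" and t: "minimally_tough t G"
  shows "\<not> complete_digraph (card (pverts G)) (with_proj G)"
    and "\<And>S. S \<subseteq> pverts G \<Longrightarrow> ncomp (pverts G - S) (parcs G) > 1 \<Longrightarrow>
      t * real (ncomp (pverts G - S) (parcs G)) \<le> real (card S)"
    and "\<And>u v. (u, v) \<in> parcs G \<Longrightarrow> \<exists>S \<subseteq> pverts G. ncomp (pverts G - S) (parcs G - {(u, v), (v, u)}) > 1 \<and>
      real (card S) < t * real (ncomp (pverts G - S) (parcs G - {(u, v), (v, u)}))"
proof -
  have \<tau>: "\<tau> (with_proj G) = ereal t" using t by (simp add: minimally_tough_def)
  show nc: "\<not> complete_digraph (card (pverts G)) (with_proj G)"
  proof
    assume "complete_digraph (card (pverts G)) (with_proj G)"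
    then have "\<tau> (with_proj G) = \<infinity>"
      unfolding toughness_def with_proj_simps by (rule if_P)
    then show False using \<tau> by simp
  qed
  have "tough t (with_proj G)"
    by (rule tough_Greatest[OF G nc, THEN iffD2]) (use \<tau> toughness_real[OF nc] in simp)
  then show "t * real (ncomp (pverts G - S) (parcs G)) \<le> real (card S)"
    if "S \<subseteq> pverts G" "ncomp (pverts G - S) (parcs G) > 1" for S
    using that by (simp add: tough_def num_components_del_verts[OF G])
  fix u v assume uv: "(u, v) \<in> parcs G"
  let ?F = "del_edge G u v"
  have F: "pair_graph ?F" using G by (rule pair_graph_del_edge)
  have lt: "\<tau> (with_proj ?F) < ereal t" using t uv by (auto simp: minimally_tough_def)
  have ncF: "\<not> complete_digraph (card (pverts ?F)) (with_proj ?F)"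
  proof
    assume "complete_digraph (card (pverts ?F)) (with_proj ?F)"
    then have "\<tau> (with_proj ?F) = \<infinity>"
      unfolding toughness_def with_proj_simps by (rule if_P)
    then show False using lt by simp
  qed
  have "\<not> t \<le> (GREATEST t. tough t (with_proj ?F))"
    using lt unfolding toughness_real[OF ncF] by simp
  then have "\<not> tough t (with_proj ?F)"
    using tough_Greatest[OF F ncF, THEN iffD1] by blast
  then show "\<exists>S \<subseteq> pverts G. ncomp (pverts G - S) (parcs G - {(u, v), (v, u)}) > 1 \<and>
      real (card S) < t * real (ncomp (pverts G - S) (parcs G - {(u, v), (v, u)}))"
    unfolding tough_def num_components_del_verts[OF F] by (auto simp: del_edge_def not_le)
qed

text \<open>Deleting the edge \<open>xu\<close> splits off \<open>x\<close> as a component. Returning \<open>K - {x, u}\<close> to the graph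
  merges no further components, since \<open>u\<close> is adjacent to all neighbours of those vertices.\<close>

lemma minimally_tough_clique_closed:
  assumes G: "pair_graph G" and t: "minimally_tough t G" "t > 1/2"
    and K: "K \<subseteq> pverts G" "\<forall>x\<in>K. \<forall>y\<in>K. x \<noteq> y \<longrightarrow> (x, y) \<in> parcs G"
    and u: "u \<in> K" "\<forall>x\<in>K. \<forall>w. (x, w) \<in> parcs G \<longrightarrow> w = u \<or> (u, w) \<in> parcs G"
    and card: "2 * t \<le> real (card K) - 1"
    and x: "x \<in> K" "x \<noteq> u" "(x, z) \<in> parcs G"
  shows "z \<in> K"
proof (rule ccontr)
  assume z: "z \<notin> K"
  interpret pair_graph G by fact
  let ?V = "pverts G" and ?E = "parcs G"
  let ?E' = "?E - {(x, u), (u, x)}"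
  have sym: "sym ?E" "sym ?E'" using arcs_symmetric by (auto simp: sym_def)
  note tough = minimally_toughD(2)[OF G t(1)]
  have xu: "(x, u) \<in> ?E" "(u, x) \<in> ?E" using K(2) x u by auto
  obtain S where S: "S \<subseteq> ?V" "ncomp (?V - S) ?E' > 1" "real (card S) < t * real (ncomp (?V - S) ?E')"
    using minimally_toughD(3)[OF G t(1) xu(1)] by blast
  define W where "W = ?V - S"
  have fW: "finite W" and fK: "finite K" and fS: "finite S"
    using pair_finite_verts K(1) S(1) by (auto simp: W_def intro: finite_subset)
  \<comment> \<open>If losing the edge \<open>xu\<close> left connectivity in \<open>W\<close>
    unchanged, \<open>S\<close> would violate the toughness of \<open>G\<close> itself.\<close>
  have bridge: "\<not> connected_in W ?E \<subseteq> connected_in W ?E'"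
  proof
    assume "connected_in W ?E \<subseteq> connected_in W ?E'"
    then have le: "ncomp W ?E' \<le> ncomp W ?E"
      unfolding ncomp_def[of W ?E'] by (intro card_components_le_ncomp fW sym) auto
    then have "t * real (ncomp W ?E) \<le> real (card S)"
      using tough[OF S(1)] S(2) by (simp add: W_def)
    moreover have "t * real (ncomp W ?E') \<le> t * real (ncomp W ?E)"
      using le t(2) by (intro mult_left_mono) auto
    ultimately show False using S(3) by (simp add: W_def)
  qed
  have inW: "x \<in> W" "u \<in> W"
  proof -
    have "connected_in W ?E = connected_in W ?E'" if "\<not> (x \<in> W \<and> u \<in> W)"
    proof -
      have "?E \<inter> W \<times> W = ?E' \<inter> W \<times> W" using that by blast
      then show ?thesis by (simp add: connected_in_def)
    qed
    then show "x \<in> W" "u \<in> W" using bridge by blast+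
  qed
  \<comment> \<open>Any other neighbour \<open>w\<close> of \<open>x\<close> in \<open>W\<close> is
    adjacent to \<open>u\<close>, and the path \<open>x, w, u\<close> would replace the lost
    edge.\<close>
  have isolated: "w = u" if w: "w \<in> W" "(x, w) \<in> ?E" for w
  proof (rule ccontr)
    assume "w \<noteq> u"
    moreover have "w \<noteq> x" using w no_loops' by blast
    moreover have "(u, w) \<in> ?E" using u(2)[rule_format, OF x(1) w(2)] \<open>w \<noteq> u\<close> by blast
    ultimately have "(x, w) \<in> ?E' \<inter> W \<times> W" "(w, u) \<in> ?E' \<inter> W \<times> W"
      using w inW x(2) arcs_symmetric by auto
    then have "(x, u) \<in> connected_in W ?E'"
      unfolding connected_in_def by (meson r_into_rtrancl rtrancl_into_rtrancl)
    moreover from this have "(u, x) \<in> connected_in W ?E'" by (rule connected_in_sym[OF sym(2)])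
    ultimately have "?E \<inter> W \<times> W \<subseteq> (?E' \<inter> W \<times> W)\<^sup>*"
      unfolding connected_in_def by auto
    then have "connected_in W ?E \<subseteq> connected_in W ?E'"
      unfolding connected_in_def by (rule rtrancl_subset_rtrancl)
    then show False using bridge by blast
  qed
  have KW: "y = u \<or> y = x" if "y \<in> K" "y \<in> W" for y
    using isolated[OF that(2)] K(2)[rule_format, OF x(1) that(1)] by blast
  define S' where "S' = S - (K - {x, u})"
  define W' where "W' = ?V - S'"
  have KS: "K - {x, u} \<subseteq> S" using KW K(1) by (auto simp: W_def)
  have W'_K: "y \<in> W" if "y \<in> W'" "y \<notin> K" for y using that by (auto simp: W_def W'_def S'_def)
  \<comment> \<open>\<open>\<rho>\<close> collapses \<open>K\<close> to \<open>u\<close>. An edge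
    inside \<open>W'\<close> becomes a point or an edge of \<open>?E'\<close> inside
    \<open>W\<close>, as each neighbour of a vertex of \<open>K\<close> is \<open>u\<close> or a
    neighbour of \<open>u\<close>.\<close>
  define \<rho> where "\<rho> = (\<lambda>y. if y \<in> K then u else y)"
  have retract: "(\<rho> a, \<rho> b) \<in> connected_in W ?E'" if "(a, b) \<in> connected_in W' ?E" for a b
    using that unfolding connected_in_def
  proof (induction rule: rtrancl_induct)
    case (step y y')
    then have e: "(y, y') \<in> ?E" "(y', y) \<in> ?E" "y \<in> W'" "y' \<in> W'"
      using arcs_symmetric by auto
    have "\<rho> y = \<rho> y' \<or> (\<rho> y, \<rho> y') \<in> ?E' \<inter> W \<times> W"
      using u(2)[rule_format, OF _ e(1)] u(2)[rule_format, OF _ e(2)] e W'_K inW u(1) x(1) arcs_symmetric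
      by (cases "y \<in> K"; cases "y' \<in> K") (auto simp: \<rho>_def)
    then show ?case using step.IH by (auto intro: rtrancl_into_rtrancl)
  qed simp
  \<comment> \<open>\<open>\<rho>\<close> fixes every vertex of \<open>W\<close> except
    \<open>x\<close>, whose component accounts for the \<open>+ 1\<close>.\<close>
  have le: "ncomp W ?E' \<le> ncomp W' ?E + 1"
  proof -
    let ?C = "\<lambda>a. connected_in W ?E' `` {a}"
    have "\<rho> a = a" if "a \<in> W - {x}" for a using KW that by (auto simp: \<rho>_def)
    then have "card (?C ` (W - {x})) \<le> ncomp W' ?E"
      using retract pair_finite_verts
      by (intro card_components_le_ncomp sym) (force simp: W_def W'_def S'_def)+
    moreover have "?C ` W = insert (?C x) (?C ` (W - {x}))" using inW by blast
    then have "ncomp W ?E' \<le> Suc (card (?C ` (W - {x})))"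
      using fW by (simp add: ncomp_def card_insert_if)
    ultimately show ?thesis by simp
  qed
  have cK: "card (K - {x, u}) + 2 = card K"
  proof -
    have "card {x, u} \<le> card K" using fK x u by (intro card_mono) auto
    then show ?thesis using fK x u by (simp add: card_Diff_subset)
  qed
  have cS: "card S = card S' + card (K - {x, u})"
    using card_Diff_subset[OF finite_subset[OF KS fS] KS] card_mono[OF fS KS] by (simp add: S'_def)
  show False
  proof (cases "ncomp W' ?E > 1")
    case True
    have "S' \<subseteq> ?V" using S(1) by (auto simp: S'_def)
    then have "t * real (ncomp W' ?E) \<le> real (card S')" using tough True by (simp add: W'_def)
    moreover have "t * real (ncomp W ?E') \<le> t * real (ncomp W' ?E + 1)"
      using le t(2) by (intro mult_left_mono) auto
    ultimately have "real (card (K - {x, u})) < t"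
      using S(3) cS by (simp add: W_def algebra_simps)
    \<comment> \<open>With \<open>card\<close> the bound leaves only a clique of two vertices, and
      then \<open>2 * t \<le> 1\<close>.\<close>
    moreover from this have "card (K - {x, u}) = 0" using card cK by linarith
    ultimately show False using card cK t(2) by linarith
  next
    case False
    then have "t * real (ncomp W ?E') \<le> t * 2" using le t(2) by (intro mult_left_mono) auto
    then have "real (card S) < 2 * t" using S(3) by (simp add: W_def)
    \<comment> \<open>Being a neighbour of \<open>x\<close> other than \<open>u\<close>,
      \<open>z\<close> cannot be in \<open>W\<close>. With \<open>K - {x, u}\<close> it gives
      \<open>S\<close> at least \<open>card K - 1\<close> elements, which is at least
      \<open>2 * t\<close>.\<close>
    moreover have "z \<in> S" using isolated[of z] x(3) z u(1) in_arcsD2[OF x(3)] by (auto simp: W_def)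
    then have "card (insert z (K - {x, u})) \<le> card S" using KS fS by (intro card_mono) auto
    then have "card K - 1 \<le> card S" using z fK cK by simp
    ultimately show False using card by linarith
  qed
qed

theorem corollary4p3:
  fixes t :: real and G :: "'a pair_pre_digraph"
  assumes "t \<in> \<rat>" and "t > 1/2"
    and "pair_graph G"
    and "minimally_tough t G"
  shows "has_hole G \<or> (\<exists>k\<ge>3. contains_induced G (sun_graph k))"
proof (rule ccontr)
  assume neg: "\<not> ?thesis"
  interpret pair_graph G by fact
  let ?V = "pverts G" and ?E = "parcs G"
  have sym: "sym ?E" using arcs_symmetric by (auto simp: sym_def)
  note t = assms(2) and G = assms(3) and min = assms(4)
  note tough = minimally_toughD(2)[OF G min]
  have two: "2 * t \<le> real (card S)"
    if S: "S \<subseteq> ?V" and "a \<in> ?V - S" "b \<in> ?V - S" "(a, b) \<notin> connected_in (?V - S) ?E" for S a b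
  proof -
    have n: "ncomp (?V - S) ?E > 1"
      using that pair_finite_verts sym by (intro ncomp_gt_1I[of _ _ a b]) auto
    then have "t * 2 \<le> t * real (ncomp (?V - S) ?E)" using t by (intro mult_left_mono) auto
    then show ?thesis using tough[OF S n] by simp
  qed
  have nc: "\<not> (\<forall>x\<in>?V. \<forall>y\<in>?V. x \<noteq> y \<longrightarrow> (x, y) \<in> ?E)"
  proof
    assume complete: "\<forall>x\<in>?V. \<forall>y\<in>?V. x \<noteq> y \<longrightarrow> (x, y) \<in> ?E"
    have "(a, b) \<in> ?E \<longleftrightarrow> (a, b) \<in> ?V \<times> ?V \<and> a \<noteq> b" for a b
      using complete in_arcsD1[of a b] in_arcsD2[of a b] no_loops'[of a b] by blast
    then have "?E = {(a, b). (a, b) \<in> ?V \<times> ?V \<and> a \<noteq> b}" by auto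
    then show False
      using minimally_toughD(1)[OF G min] pair_finite_verts by (simp add: complete_digraph_pair_def)
  qed
  have V: "?V \<noteq> {}" using nc by blast
  have nh: "\<not> has_hole G" and ns: "\<nexists>k. k \<ge> 3 \<and> contains_induced G (sun_graph k)"
    using neg by blast+
  obtain v K u where K: "v \<in> K" "u \<in> K" "K \<subseteq> ?V"
    and clique: "\<forall>x\<in>K. \<forall>y\<in>K. x \<noteq> y \<longrightarrow> (x, y) \<in> ?E"
    and simplicial: "\<forall>w. (v, w) \<in> ?E \<longrightarrow> w \<in> K"
    and maximum: "\<forall>x\<in>K. \<forall>w. (x, w) \<in> ?E \<longrightarrow> w = u \<or> (u, w) \<in> ?E"
    by (rule ex_simplicial_maximum_neighbour[OF nh ns V])
  obtain w where w: "w \<in> ?V - K" using nc clique by blast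
  have fK: "finite K" using K(3) pair_finite_verts by (rule finite_subset)
  \<comment> \<open>All neighbours of \<open>v\<close> are in \<open>K\<close>, so deleting the rest
    of \<open>K\<close> cuts \<open>v\<close> off from \<open>w\<close>.\<close>
  have "2 * t \<le> real (card (K - {v}))"
  proof (rule two)
    show "(v, w) \<notin> connected_in (?V - (K - {v})) ?E"
    proof
      assume "(v, w) \<in> connected_in (?V - (K - {v})) ?E"
      then have "w \<in> {v}" by (rule connected_in_closed) (use simplicial in blast)+
      then show False using w K(1) by blast
    qed
  qed (use K w in auto)
  moreover have "card (K - {v}) + 1 = card K" using card_Suc_Diff1[OF fK K(1)] by simp
  ultimately have card: "2 * t \<le> real (card K) - 1" by linarith
  then have "\<not> K \<subseteq> {u}" using t card_mono[of "{u}" K] by auto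
  then obtain x where x: "x \<in> K" "x \<noteq> u" by blast
  \<comment> \<open>No vertex of \<open>K\<close> other than \<open>u\<close> has a neighbour
    outside \<open>K\<close>, so \<open>u\<close> alone separates \<open>x\<close> from
    \<open>w\<close>.\<close>
  have "2 * t \<le> real (card {u})"
  proof (rule two)
    show "(x, w) \<notin> connected_in (?V - {u}) ?E"
    proof
      assume "(x, w) \<in> connected_in (?V - {u}) ?E"
      then have "w \<in> K - {u}"
      proof (rule connected_in_closed)
        show "z \<in> K - {u}" if "y \<in> K - {u}" "z \<in> ?V - {u}" "(y, z) \<in> ?E" for y z
          using minimally_tough_clique_closed[OF G min t K(3) clique K(2) maximum card _ _ that(3)] that
          by blast
      qed (use x in auto)
      then show False using w by blast
    qed
  qed (use K x w in auto)
  then show False using t by simp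
qed

end
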